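(* Let $H$ be a multigraph obtained from a cycle by fattening all of its edges except one. Then $H$ is widespread.
   Context: All graphs are finite and simple; all multigraphs are finite and loopless. Fattening an edge $e=uv$ of a multigraph means replacing $e$ by some nonempty set of parallel edges all joining $u,v$. If $H$ is a multigraph, a subdivision of $H$ is a (simple) graph $J$ obtained from $H$ by replacing each edge $uv$ by a path of length at least one joining $u,v$, such that these paths are vertex-disjoint except for their ends. A graph $G$ is $J$-subdivision-free if no induced subgraph of $G$ is (isomorphic to) a subdivision of $J$. For an integer $\rho\ge 0$ and $v\in V(G)$, $N^{\rho}_G[v]$ is the set of vertices of $G$ with distance at most $\rho$ from $v$, and $\chi^{\rho}(G)$ is the maximum over all $v\in V(G)$ of the chromatic number of $G[N^{\rho}_G[v]]$ (zero for the null graph). An ideal is a class of graphs closed under taking induced subgraphs (up to isomorphism). An ideal $\mathcal{C}$ is colourable if there exists $k$ such that every member of $\mathcal{C}$ has chromatic number at most $k$; it is $\rho$-bounded if there exists $\tau$ such that $\chi^{\rho}(G)\le\tau$ for all $G\in\mathcal{C}$. A multigraph $H$ is widespread if for every subdivision $J$ of $H$ there exists $\rho\ge 0$ such that every $\rho$-bounded ideal of $J$-subdivision-free graphs is colourable. *)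

theory Defs
  imports Main "HOL-Library.Extended_Nat"
begin

section \<open>Simple graphs\<close>

text \<open>An edge of a simple graph is the two-element set of its ends.\<close>

record 'a graph =
  verts :: "'a set"
  edges :: "'a set set"

definition simple_graph :: "'a graph \<Rightarrow> bool" where
  "simple_graph G \<longleftrightarrow>
     finite (verts G) \<and> (\<forall>e\<in>edges G. e \<subseteq> verts G \<and> card e = 2)"

definition induced :: "'a graph \<Rightarrow> 'a set \<Rightarrow> 'a graph" where
  "induced G S = \<lparr>verts = verts G \<inter> S, edges = {e \<in> edges G. e \<subseteq> S}\<rparr>"

definition graph_iso :: "'a graph \<Rightarrow> 'b graph \<Rightarrow> bool" where
  "graph_iso G K \<longleftrightarrow>
     (\<exists>f. bij_betw f (verts G) (verts K) \<and> edges K = (\<lambda>e. f ` e) ` edges G)"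

definition path_edges :: "'a list \<Rightarrow> 'a set set" where
  "path_edges p = {{p ! i, p ! Suc i} |i. Suc i < length p}"

definition is_path :: "'a graph \<Rightarrow> 'a list \<Rightarrow> bool" where
  "is_path G p \<longleftrightarrow>
     p \<noteq> [] \<and> distinct p \<and> set p \<subseteq> verts G \<and> path_edges p \<subseteq> edges G"

definition graph_dist :: "'a graph \<Rightarrow> 'a \<Rightarrow> 'a \<Rightarrow> enat" where
  "graph_dist G u v =
     (INF p \<in> {p. is_path G p \<and> hd p = u \<and> last p = v}. enat (length p - 1))"

definition nbhd :: "nat \<Rightarrow> 'a graph \<Rightarrow> 'a \<Rightarrow> 'a set" where
  "nbhd \<rho> G v = {u \<in> verts G. graph_dist G v u \<le> enat \<rho>}"

definition proper_colouring :: "'a graph \<Rightarrow> nat \<Rightarrow> ('a \<Rightarrow> nat) \<Rightarrow> bool" where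
  "proper_colouring G k c \<longleftrightarrow>
     (\<forall>v\<in>verts G. c v < k) \<and> (\<forall>u v. u \<noteq> v \<longrightarrow> {u, v} \<in> edges G \<longrightarrow> c u \<noteq> c v)"

definition chromatic_number :: "'a graph \<Rightarrow> nat" where
  "chromatic_number G = (LEAST k. \<exists>c. proper_colouring G k c)"

definition local_chromatic_number :: "nat \<Rightarrow> 'a graph \<Rightarrow> nat" where
  "local_chromatic_number \<rho> G =
     (if verts G = {} then 0
      else Max ((\<lambda>v. chromatic_number (induced G (nbhd \<rho> G v))) ` verts G))"

definition is_cycle :: "'a graph \<Rightarrow> bool" where
  "is_cycle G \<longleftrightarrow>
     (\<exists>xs. 3 \<le> length xs \<and> distinct xs \<and> verts G = set xs \<and>
           edges G = {{xs ! i, xs ! (Suc i mod length xs)} |i. i < length xs})"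


section \<open>Multigraphs\<close>

text \<open>Edges have an identity of their own; \<open>mends H e\<close> is the set of the two ends of \<open>e\<close>.\<close>

record ('v, 'e) mgraph =
  mverts :: "'v set"
  medges :: "'e set"
  mends :: "'e \<Rightarrow> 'v set"

definition multigraph :: "('v, 'e) mgraph \<Rightarrow> bool" where
  "multigraph H \<longleftrightarrow>
     finite (mverts H) \<and> finite (medges H) \<and>
     (\<forall>e\<in>medges H. mends H e \<subseteq> mverts H \<and> card (mends H e) = 2)"

definition mgraph_of :: "'a graph \<Rightarrow> ('a, 'a set) mgraph" where
  "mgraph_of G = \<lparr>mverts = verts G, medges = edges G, mends = (\<lambda>e. e)\<rparr>"

text \<open>\<open>H\<close> is obtained from \<open>H0\<close> by fattening exactly the edges in \<open>F\<close>. The map \<open>\<pi>\<close> sends each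
  edge of \<open>H\<close> to the edge of \<open>H0\<close> it replaces; its fibres are the parallel classes that are
  inserted, and the fibre of an edge outside \<open>F\<close> is a single edge.\<close>

definition obtained_by_fattening ::
    "'f set \<Rightarrow> ('v, 'f) mgraph \<Rightarrow> ('v, 'e) mgraph \<Rightarrow> bool" where
  "obtained_by_fattening F H0 H \<longleftrightarrow>
     multigraph H \<and> mverts H = mverts H0 \<and>
     (\<exists>\<pi>. \<pi> ` medges H = medges H0 \<and>
          (\<forall>e\<in>medges H. mends H e = mends H0 (\<pi> e)) \<and>
          (\<forall>f\<in>medges H0 - F. \<exists>!e. e \<in> medges H \<and> \<pi> e = f))"

definition inner_verts :: "'a list \<Rightarrow> 'a set" where
  "inner_verts p = set (butlast (tl p))"

text \<open>\<open>J\<close> is a subdivision of \<open>H\<close>, up to isomorphism: \<open>\<phi>\<close> places the vertices of \<open>H\<close> in \<open>J\<close>, and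
  \<open>P e\<close> is the path of \<open>J\<close> replacing the edge \<open>e\<close>. These paths have length at least one because
  their ends are distinct. Disjointness of their edge sets, beyond that of their interiors, only
  matters for parallel edges: at most one of them can remain an edge of the simple graph \<open>J\<close>.\<close>

definition is_subdivision :: "'a graph \<Rightarrow> ('v, 'e) mgraph \<Rightarrow> bool" where
  "is_subdivision J H \<longleftrightarrow>
     simple_graph J \<and>
     (\<exists>\<phi> P. inj_on \<phi> (mverts H) \<and>
        (\<forall>e\<in>medges H. is_path J (P e) \<and> {hd (P e), last (P e)} = \<phi> ` mends H e \<and>
                      inner_verts (P e) \<inter> \<phi> ` mverts H = {}) \<and>
        (\<forall>e\<in>medges H. \<forall>f\<in>medges H. e \<noteq> f \<longrightarrow>
            inner_verts (P e) \<inter> inner_verts (P f) = {} \<and>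
            path_edges (P e) \<inter> path_edges (P f) = {}) \<and>
        verts J = \<phi> ` mverts H \<union> (\<Union>e\<in>medges H. set (P e)) \<and>
        edges J = (\<Union>e\<in>medges H. path_edges (P e)))"

text \<open>\<open>is_subdivision\<close> is invariant under isomorphism of its first argument, so no separate
  isomorphism is needed here.\<close>

definition subdivision_free :: "('v, 'e) mgraph \<Rightarrow> 'a graph \<Rightarrow> bool" where
  "subdivision_free J G \<longleftrightarrow> \<not> (\<exists>S \<subseteq> verts G. is_subdivision (induced G S) J)"


section \<open>Ideals and widespread multigraphs\<close>

text \<open>Every finite graph has an isomorphic copy with vertices in \<open>nat\<close>, so isomorphism-closed
  classes of finite graphs are represented by sets of graphs on \<open>nat\<close>.\<close>

definition ideal :: "nat graph set \<Rightarrow> bool" where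
  "ideal \<C> \<longleftrightarrow>
     (\<forall>G\<in>\<C>. simple_graph G) \<and>
     (\<forall>G\<in>\<C>. \<forall>S \<subseteq> verts G. \<forall>K. graph_iso (induced G S) K \<longrightarrow> K \<in> \<C>)"

definition colourable :: "nat graph set \<Rightarrow> bool" where
  "colourable \<C> \<longleftrightarrow> (\<exists>k. \<forall>G\<in>\<C>. chromatic_number G \<le> k)"

definition rho_bounded :: "nat \<Rightarrow> nat graph set \<Rightarrow> bool" where
  "rho_bounded \<rho> \<C> \<longleftrightarrow> (\<exists>\<tau>. \<forall>G\<in>\<C>. local_chromatic_number \<rho> G \<le> \<tau>)"

definition widespread :: "('v, 'e) mgraph \<Rightarrow> bool" where
  "widespread H \<longleftrightarrow>
     (\<forall>J :: nat graph. is_subdivision J H \<longrightarrow>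
        (\<exists>\<rho>. \<forall>\<C>. ideal \<C> \<and> rho_bounded \<rho> \<C> \<and> (\<forall>G\<in>\<C>. subdivision_free (mgraph_of J) G)
               \<longrightarrow> colourable \<C>))"

end

theory Submission
  imports Defs
begin

text \<open>Take a breadth-first level \<open>C\<close> of large chromatic number, with parents \<open>x y\<close> of its vertices
  \<open>y\<close>. Call the level rich if every subset of large chromatic number contains a connected set \<open>U\<close>
  and a set \<open>C'\<close> of large chromatic number, anticomplete to \<open>U\<close>, such that \<open>x y\<close> has a neighbour in
  \<open>U\<close> for all \<open>y\<close> in \<open>C'\<close>.

  If some level is rich, parents serve as branch vertices. Pick \<open>v\<^sub>1, v\<^sub>2, \<dots>\<close> one after the other,
  after each \<open>v\<^sub>t\<close> restricting to vertices far from it and building a block of sets \<open>U\<close> there. The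
  parallel paths from \<open>x v\<^sub>t\<close> to \<open>x v\<^sub>t\<^sub>+\<^sub>1\<close> run through the block built just before \<open>v\<^sub>t\<close>, and
  \<open>v\<^sub>t\<^sub>+\<^sub>1\<close> is chosen closer to \<open>x v\<^sub>t\<close>, within many sets of this block, than everything selected later,
  so that these paths avoid the later branch vertices. The one edge that is not fattened is closed
  through the levels above the parents; all parents are equally far from the root, so this path
  meets no other branch vertex.

  If no level is rich, breadth-first levels can be nested so that \<open>x\<^sub>i y\<close> has a neighbour in the upper
  part \<open>U\<^sub>j\<close> of the \<open>j\<close>-th search only if \<open>i = j\<close>. Then far-apart vertices \<open>y\<close> of the innermost level
  serve as branch vertices, and each edge gets its own \<open>U\<^sub>i\<close>.\<close>

section \<open>Colourability and connectivity of vertex sets\<close>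

text \<open>One bound has to serve the whole ideal, so every bound may depend on numbers only. This
  is why \<open>rich\<close> carries a function \<open>\<phi>\<close> and why the two cases
  interlock: the bound for \<open>N\<close> nested searches determines \<open>\<phi>\<close>; if
  richness holds for this \<open>\<phi>\<close>, a fat cycle appears, and if it fails, one more
  search can be added outside. Only the rich case limits the theorem. The parallel paths run inside
  one level there, and the levels above its parents supply just one further connected set, hence one
  edge that is not fattened. Two obstacles shape the details. A path through a set may be seen by
  later parents; comparing distances settles this in one of two directions for each set, so blocks
  hold twice as many sets as needed. Without rich levels, the parents of a single \<open>y\<close>
  may be adjacent to each other; they lie in a ball around \<open>y\<close>, and a colouring of that
  ball selects an independent family. Distances between branch vertices serve twice: they forbid
  unwanted adjacencies, and they make the paths so long that the subdivision of \<open>H\<close>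
  also subdivides \<open>J\<close>.\<close>

definition col :: "('a \<Rightarrow> 'a \<Rightarrow> bool) \<Rightarrow> 'a set \<Rightarrow> nat \<Rightarrow> bool" where
  "col A S k \<longleftrightarrow> (\<exists>c::'a \<Rightarrow> nat. (\<forall>v\<in>S. c v < k) \<and> (\<forall>u\<in>S. \<forall>v\<in>S. A u v \<longrightarrow> c u \<noteq> c v))"

definition adj_in :: "('a \<Rightarrow> 'a \<Rightarrow> bool) \<Rightarrow> 'a set \<Rightarrow> ('a \<times> 'a) set" where
  "adj_in A S = {(u, v). u \<in> S \<and> v \<in> S \<and> A u v}"

definition conn :: "('a \<Rightarrow> 'a \<Rightarrow> bool) \<Rightarrow> 'a set \<Rightarrow> bool" where
  "conn A S \<longleftrightarrow> (\<forall>u\<in>S. \<forall>v\<in>S. (u, v) \<in> (adj_in A S)\<^sup>*)"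

definition anti :: "('a \<Rightarrow> 'a \<Rightarrow> bool) \<Rightarrow> 'a set \<Rightarrow> 'a set \<Rightarrow> bool" where
  "anti A S T \<longleftrightarrow> S \<inter> T = {} \<and> (\<forall>u\<in>S. \<forall>v\<in>T. \<not> A u v)"

definition touches :: "('a \<Rightarrow> 'a \<Rightarrow> bool) \<Rightarrow> 'a \<Rightarrow> 'a set \<Rightarrow> bool" where
  "touches A v S \<longleftrightarrow> (\<exists>u\<in>S. A v u)"

text \<open>Distance is taken in the whole graph, whatever subset the proof currently works in;
  deleting one ball therefore keeps all later choices far away.\<close>

definition near :: "('a \<Rightarrow> 'a \<Rightarrow> bool) \<Rightarrow> nat \<Rightarrow> 'a \<Rightarrow> 'a \<Rightarrow> bool" where
  "near A r u v \<longleftrightarrow> (\<exists>j\<le>r. (u, v) \<in> adj_in A UNIV ^^ j)"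

definition locally_col :: "('a \<Rightarrow> 'a \<Rightarrow> bool) \<Rightarrow> nat \<Rightarrow> nat \<Rightarrow> bool" where
  "locally_col A \<tau> \<rho> \<longleftrightarrow> symp A \<and> irreflp A \<and> (\<forall>v. col A {u. near A \<rho> v u} \<tau>)"

lemma col_mono: "col A T l \<Longrightarrow> S \<subseteq> T \<Longrightarrow> l \<le> k \<Longrightarrow> col A S k"
proof -
  assume "col A T l" "S \<subseteq> T" "l \<le> k"
  then obtain c where "\<forall>v\<in>T. c v < l" "\<forall>u\<in>T. \<forall>v\<in>T. A u v \<longrightarrow> c u \<noteq> (c v :: nat)"
    unfolding col_def by blast
  then have "\<forall>v\<in>S. c v < k" "\<forall>u\<in>S. \<forall>v\<in>S. A u v \<longrightarrow> c u \<noteq> c v"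
    using \<open>S \<subseteq> T\<close> \<open>l \<le> k\<close> by (auto intro: less_le_trans)
  then show ?thesis unfolding col_def by blast
qed

lemma col_empty: "col A {} k"
  by (simp add: col_def)

lemma col_Un:
  assumes "col A S k" "col A T l"
  shows "col A (S \<union> T) (k + l)"
proof -
  obtain c where c: "\<forall>v\<in>S. c v < k" "\<forall>u\<in>S. \<forall>v\<in>S. A u v \<longrightarrow> c u \<noteq> c v"
    using assms(1) unfolding col_def by blast
  obtain d where d: "\<forall>v\<in>T. d v < l" "\<forall>u\<in>T. \<forall>v\<in>T. A u v \<longrightarrow> d u \<noteq> d v"
    using assms(2) unfolding col_def by blast
  let ?f = "\<lambda>v. if v \<in> S then c v else k + d v"
  have "\<forall>v\<in>S \<union> T. ?f v < k + l" using c d by auto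
  moreover have "\<forall>u\<in>S \<union> T. \<forall>v\<in>S \<union> T. A u v \<longrightarrow> ?f u \<noteq> ?f v"
    using c d by (auto dest: bspec)
  ultimately show ?thesis unfolding col_def by (intro exI[of _ ?f] conjI)
qed

lemma not_col_diff:
  assumes "\<not> col A S (k + l)" "col A T l"
  shows "\<not> col A (S - T) k"
proof
  assume "col A (S - T) k"
  then have "col A ((S - T) \<union> T) (k + l)" using assms(2) by (rule col_Un)
  then show False using assms(1) by (metis Un_Diff_cancel2 Un_upper1 col_mono order_refl)
qed

lemma not_col_obtains: 
  assumes "\<not> col A S k"
  obtains v where "v \<in> S"
  using assms col_empty by (metis ex_in_conv)

lemma col_UN:
  fixes N :: nat
  assumes "\<And>i. i < N \<Longrightarrow> col A (T i) l"
  shows "col A (\<Union>i<N. T i) (N * l)"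
  using assms
proof (induction N)
  case 0
  then show ?case by (simp add: col_empty)
next
  case (Suc N)
  then have "col A ((\<Union>i<N. T i) \<union> T N) (N * l + l)" by (intro col_Un) auto
  then show ?case by (simp add: lessThan_Suc Un_commute add.commute)
qed

lemma locally_colD:
  assumes "locally_col A \<tau> \<rho>"
  shows "A u v \<Longrightarrow> A v u" "\<not> A u u" "col A {u. near A \<rho> v u} \<tau>"
  using assms unfolding locally_col_def by (auto dest: sympD irreflpD)

lemma anti_sym: "symp A \<Longrightarrow> anti A S T \<Longrightarrow> anti A T S"
  unfolding anti_def by (meson disjoint_iff sympD)

lemma anti_mono: "anti A S T \<Longrightarrow> S' \<subseteq> S \<Longrightarrow> T' \<subseteq> T \<Longrightarrow> anti A S' T'"
  unfolding anti_def by blast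

lemma adj_in_mono: "S \<subseteq> T \<Longrightarrow> adj_in A S \<subseteq> adj_in A T"
  unfolding adj_in_def by auto

lemma sym_adj_in: "symp A \<Longrightarrow> sym (adj_in A S)"
  unfolding adj_in_def by (auto intro!: symI dest: sympD)

lemma conn_from_root:
  assumes "symp A" "\<And>v. v \<in> S \<Longrightarrow> (z, v) \<in> (adj_in A S)\<^sup>*"
  shows "conn A S"
  unfolding conn_def
  by (meson assms rtrancl_trans sym_adj_in sym_rtrancl symD)

lemma conn_insert:
  assumes "symp A" "conn A S" "touches A v S"
  shows "conn A (insert v S)"
proof (rule conn_from_root[OF assms(1), of _ v])
  obtain u where u: "u \<in> S" "A v u" using assms(3) unfolding touches_def by blast
  fix w assume "w \<in> insert v S"
  show "(v, w) \<in> (adj_in A (insert v S))\<^sup>*"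
  proof (cases "w = v")
    case False
    then have "(u, w) \<in> (adj_in A S)\<^sup>*"
      using assms(2) u \<open>w \<in> insert v S\<close> unfolding conn_def by auto
    then have "(u, w) \<in> (adj_in A (insert v S))\<^sup>*"
      using rtrancl_mono[OF adj_in_mono[of S "insert v S" A]] by blast
    moreover have "(v, u) \<in> adj_in A (insert v S)" using u unfolding adj_in_def by auto
    ultimately show ?thesis by (rule converse_rtrancl_into_rtrancl[rotated])
  qed simp
qed

lemma touches_mono: "touches A v S \<Longrightarrow> S \<subseteq> T \<Longrightarrow> touches A v T"
  unfolding touches_def by blast

lemma near_refl: "near A r u u"
  unfolding near_def by (intro exI[of _ 0]) simp

lemma near_mono: "near A r u v \<Longrightarrow> r \<le> s \<Longrightarrow> near A s u v"
  unfolding near_def by (meson order_trans)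

lemma near_adj: "A u v \<Longrightarrow> near A (Suc 0) u v"
  unfolding near_def adj_in_def by (intro exI[of _ "Suc 0"]) simp

lemma near_trans:
  assumes "near A r u v" "near A s v w"
  shows "near A (r + s) u w"
proof -
  obtain i j where "i \<le> r" "(u, v) \<in> adj_in A UNIV ^^ i" "j \<le> s" "(v, w) \<in> adj_in A UNIV ^^ j"
    using assms unfolding near_def by blast
  then have "(u, w) \<in> adj_in A UNIV ^^ (i + j)" "i + j \<le> r + s"
    by (auto simp: relpow_add)
  then show ?thesis unfolding near_def by blast
qed

lemma near_sym:
  assumes "symp A" "near A r u v"
  shows "near A r v u"
proof -
  have "(v, u) \<in> adj_in A UNIV ^^ j" if "(u, v) \<in> adj_in A UNIV ^^ j" for j u v
    using that
  proof (induction j arbitrary: v)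
    case (Suc j)
    then obtain w where w: "(u, w) \<in> adj_in A UNIV ^^ j" "(w, v) \<in> adj_in A UNIV" by auto
    then have "(v, w) \<in> adj_in A UNIV" using sym_adj_in[OF assms(1)] by (meson symD)
    then show ?case using Suc.IH[OF w(1)] by (rule relpow_Suc_I2)
  qed simp
  then show ?thesis using assms(2) unfolding near_def by blast
qed

lemma relpow_adj_in_mono: "S \<subseteq> T \<Longrightarrow> (u, v) \<in> adj_in A S ^^ j \<Longrightarrow> (u, v) \<in> adj_in A T ^^ j"
proof (induction j arbitrary: v)
  case (Suc j)
  then show ?case using adj_in_mono[of S T A] by auto
qed simp

section \<open>Breadth-first levels\<close>

text \<open>Distance from \<open>z\<close> inside \<open>D\<close>. Outside the component of
  \<open>z\<close> the \<open>LEAST\<close> is unspecified, so the lemmas below assume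
  reachability.\<close>

definition lev :: "('a \<Rightarrow> 'a \<Rightarrow> bool) \<Rightarrow> 'a set \<Rightarrow> 'a \<Rightarrow> 'a \<Rightarrow> nat" where
  "lev A D z v = (LEAST j. (z, v) \<in> adj_in A D ^^ j)"

lemma lev_le: "(z, v) \<in> adj_in A D ^^ j \<Longrightarrow> lev A D z v \<le> j"
  unfolding lev_def by (rule Least_le)

lemma lev_relpow:
  assumes "(z, v) \<in> (adj_in A D)\<^sup>*"
  shows "(z, v) \<in> adj_in A D ^^ lev A D z v"
  using assms unfolding lev_def by (metis LeastI rtrancl_imp_relpow)

lemma lev_adj:
  assumes "(z, u) \<in> (adj_in A D)\<^sup>*" "(u, v) \<in> adj_in A D"
  shows "lev A D z v \<le> Suc (lev A D z u)"
  by (meson assms lev_le lev_relpow relpow_Suc_I)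

lemma lev_pred:
  assumes "(z, v) \<in> (adj_in A D)\<^sup>*" "lev A D z v = Suc k"
  obtains u where "(z, u) \<in> (adj_in A D)\<^sup>*" "(u, v) \<in> adj_in A D" "lev A D z u = k"
proof -
  have "(z, v) \<in> adj_in A D ^^ Suc k" using assms lev_relpow by metis
  then obtain u where u: "(z, u) \<in> adj_in A D ^^ k" "(u, v) \<in> adj_in A D" by auto
  have r: "(z, u) \<in> (adj_in A D)\<^sup>*" using u(1) by (rule relpow_imp_rtrancl)
  have "lev A D z u \<le> k" using u(1) by (rule lev_le)
  moreover have "Suc k \<le> Suc (lev A D z u)" using lev_adj[OF r u(2)] assms(2) by simp
  ultimately show ?thesis using that r u(2) by simp
qed

text \<open>An edge joins equal or consecutive levels, so two disjoint palettes of \<open>c\<close>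
  colours, alternating with the parity of the level, suffice.\<close>

lemma col_levels:
  assumes sym: "symp A" and S: "S \<subseteq> (adj_in A D)\<^sup>* `` {z}"
    and lv: "\<And>k. col A {v \<in> S. lev A D z v = k} c" and SD: "S \<subseteq> D"
  shows "col A S (c + c)"
proof -
  let ?l = "lev A D z"
  obtain f where f: "\<And>k v. v \<in> S \<Longrightarrow> ?l v = k \<Longrightarrow> f k v < c"
    "\<And>k u v. u \<in> S \<Longrightarrow> v \<in> S \<Longrightarrow> ?l u = k \<Longrightarrow> ?l v = k \<Longrightarrow> A u v \<Longrightarrow> f k u \<noteq> f k v"
  proof -
    define Q where "Q k g \<longleftrightarrow> (\<forall>v\<in>{v \<in> S. ?l v = k}. g v < c) \<and>
       (\<forall>u\<in>{v \<in> S. ?l v = k}. \<forall>v\<in>{v \<in> S. ?l v = k}. A u v \<longrightarrow> g u \<noteq> g v)"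
      for k and g :: "'a \<Rightarrow> nat"
    have "\<forall>k. \<exists>g. Q k g" using lv unfolding col_def Q_def by blast
    then obtain f where "\<forall>k. Q k (f k)" by metis
    then show thesis unfolding Q_def by (intro that[of f]) blast+
  qed
  let ?g = "\<lambda>v. f (?l v) v + (if even (?l v) then 0 else c)"
  have "?g v < c + c" if "v \<in> S" for v using f(1)[OF that refl] by auto
  moreover have "?g u \<noteq> ?g v" if uv: "u \<in> S" "v \<in> S" "A u v" for u v
  proof (cases "?l u = ?l v")
    case True
    then show ?thesis using f(2)[OF uv(1,2) True refl uv(3)] by auto
  next
    case False
    have e: "(u, v) \<in> adj_in A D" "(v, u) \<in> adj_in A D"
      using uv SD sym unfolding adj_in_def by (auto dest: sympD)
    have "?l v \<le> Suc (?l u)" "?l u \<le> Suc (?l v)"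
      using lev_adj e uv S by (metis Image_singleton_iff subsetD)+
    then have "?l v = Suc (?l u) \<or> ?l u = Suc (?l v)" using False by linarith
    then show ?thesis using f(1)[OF uv(1) refl] f(1)[OF uv(2) refl] by auto
  qed
  ultimately show ?thesis unfolding col_def by (intro exI[of _ ?g]) auto
qed

lemma col_components:
  assumes sym: "symp A" and comp: "\<And>z. z \<in> D \<Longrightarrow> col A ((adj_in A D)\<^sup>* `` {z}) c"
  shows "col A D c"
proof -
  let ?C = "\<lambda>z. (adj_in A D)\<^sup>* `` {z}"
  \<comment> \<open>The choice depends on the component as a set, so adjacent vertices, which have
    the same component, are coloured by the same function.\<close>
  define f where "f S = (SOME g::'a \<Rightarrow> nat. (\<forall>v\<in>S. g v < c) \<and> (\<forall>u\<in>S. \<forall>v\<in>S. A u v \<longrightarrow> g u \<noteq> g v))" for S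
  have f: "(\<forall>v\<in>?C z. f (?C z) v < c) \<and> (\<forall>u\<in>?C z. \<forall>v\<in>?C z. A u v \<longrightarrow> f (?C z) u \<noteq> f (?C z) v)"
    if "z \<in> D" for z
    using someI_ex[OF comp[OF that, unfolded col_def]] unfolding f_def by blast
  let ?g = "\<lambda>v. f (?C v) v"
  have "?g v < c" if "v \<in> D" for v using f[OF that] by auto
  moreover have "?g u \<noteq> ?g v" if uv: "u \<in> D" "v \<in> D" "A u v" for u v
  proof -
    have e: "(u, v) \<in> adj_in A D" "(v, u) \<in> adj_in A D"
      using uv sym unfolding adj_in_def by (auto dest: sympD)
    have "?C u = ?C v"
    proof (rule set_eqI)
      fix w show "w \<in> ?C u \<longleftrightarrow> w \<in> ?C v"
        using e by (auto intro: converse_rtrancl_into_rtrancl)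
    qed
    moreover have "u \<in> ?C u" "v \<in> ?C u" using e by auto
    ultimately show ?thesis using f[OF uv(1)] uv(3) by metis
  qed
  ultimately show ?thesis unfolding col_def by (intro exI[of _ ?g]) auto
qed

text \<open>The set \<open>C\<close> is a breadth-first level; \<open>x y\<close> and \<open>s y\<close> are the parent and the grandparent of
  \<open>y\<close>, and \<open>V\<close> consists of all levels strictly above the grandparents.\<close>

definition bfs_cover ::
    "('a \<Rightarrow> 'a \<Rightarrow> bool) \<Rightarrow> 'a set \<Rightarrow> 'a set \<Rightarrow> ('a \<Rightarrow> 'a) \<Rightarrow> ('a \<Rightarrow> 'a) \<Rightarrow> 'a set \<Rightarrow> bool" where
  "bfs_cover A D V s x C \<longleftrightarrow>
     conn A V \<and> C \<subseteq> D \<and> V \<subseteq> D \<and> anti A V C \<and> anti A (s ` C) C \<and>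
     (\<forall>y\<in>C. A y (x y) \<and> A (x y) (s y) \<and> touches A (s y) V \<and> x y \<in> D \<and> s y \<in> D \<and>
            x y \<notin> C \<and> \<not> touches A (x y) V)"

lemma exists_bfs_cover:
  assumes loc: "locally_col A \<tau> \<rho>" and "2 \<le> \<rho>" "\<tau> \<le> c" and D: "\<not> col A D (c + c)"
  obtains V s x C where "bfs_cover A D V s x C" "\<not> col A C c"
proof -
  have sym: "symp A" using loc unfolding locally_col_def by blast
  obtain z where z: "z \<in> D" "\<not> col A ((adj_in A D)\<^sup>* `` {z}) (c + c)"
    using col_components[OF sym] D by blast
  let ?S = "(adj_in A D)\<^sup>* `` {z}" and ?l = "lev A D z"
  have SD: "?S \<subseteq> D"
  proof
    fix v assume "v \<in> ?S"
    then have "(z, v) \<in> (adj_in A D)\<^sup>*" by simp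
    then show "v \<in> D" using z(1) by (induction rule: rtrancl_induct) (auto simp: adj_in_def)
  qed
  obtain k where k: "\<not> col A {v \<in> ?S. ?l v = k} c"
    using col_levels[OF sym order_refl _ SD] z(2) by blast
  let ?C = "{v \<in> ?S. ?l v = k}"
  \<comment> \<open>Levels 0 to 2 lie in a ball around \<open>z\<close> and need at most
    \<open>\<tau>\<close> colours. A deeper level leaves room for parents, grandparents and a
    nonempty \<open>V\<close>.\<close>
  have "3 \<le> k"
  proof (rule ccontr)
    assume "\<not> 3 \<le> k"
    then have "?C \<subseteq> {u. near A \<rho> z u}"
    proof (intro subsetI)
      fix v assume v: "v \<in> ?C"
      then have "(z, v) \<in> adj_in A D ^^ k" using lev_relpow[of z v A D] by auto
      then have "(z, v) \<in> adj_in A UNIV ^^ k" by (rule relpow_adj_in_mono[rotated]) simp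
      then show "v \<in> {u. near A \<rho> z u}" using \<open>\<not> 3 \<le> k\<close> assms(2) unfolding near_def
        by (auto intro!: exI[of _ k])
    qed
    then show False using k col_mono[OF locally_colD(3)[OF loc] _ assms(3)] by blast
  qed
  then have "k = Suc (Suc (Suc (k - 3)))" by simp
  then obtain m where m: "k = Suc (Suc (Suc m))" by blast
  let ?V = "{v \<in> ?S. ?l v \<le> m}"
  define anc where "anc y x s \<longleftrightarrow> x \<in> ?S \<and> s \<in> ?S \<and> (x, y) \<in> adj_in A D \<and> (s, x) \<in> adj_in A D \<and>
      ?l x = Suc (Suc m) \<and> ?l s = Suc m \<and> (\<exists>v\<in>?V. (v, s) \<in> adj_in A D)" for y x s
  have "\<exists>x s. anc y x s" if y: "y \<in> ?C" for y
  proof -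
    have "(z, y) \<in> (adj_in A D)\<^sup>*" "?l y = Suc (Suc (Suc m))" using y m by auto
    then obtain x where x: "(z, x) \<in> (adj_in A D)\<^sup>*" "(x, y) \<in> adj_in A D" "?l x = Suc (Suc m)"
      by (rule lev_pred)
    obtain s where s: "(z, s) \<in> (adj_in A D)\<^sup>*" "(s, x) \<in> adj_in A D" "?l s = Suc m"
      using x(1,3) by (rule lev_pred)
    obtain v where v: "(z, v) \<in> (adj_in A D)\<^sup>*" "(v, s) \<in> adj_in A D" "?l v = m"
      using s(1,3) by (rule lev_pred)
    show ?thesis unfolding anc_def using x s v by (intro exI[of _ x] exI[of _ s]) auto
  qed
  then obtain x s where "\<And>y. y \<in> ?C \<Longrightarrow> anc y (x y) (s y)"
    by metis
  note xs = this[unfolded anc_def]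
  have close: "?l v \<le> Suc (?l u)" if "u \<in> ?S" "v \<in> ?S" "A u v" for u v
    using that SD lev_adj[of z u A D v] unfolding adj_in_def by auto
  have V: "conn A ?V"
  proof (rule conn_from_root[OF sym])
    fix v assume "v \<in> ?V"
    then show "(z, v) \<in> (adj_in A ?V)\<^sup>*"
    proof (induction "?l v" arbitrary: v)
      case 0
      then have "(z, v) \<in> adj_in A D ^^ 0" using lev_relpow[of z v A D] by auto
      then show ?case by simp
    next
      case (Suc i)
      then obtain u where u: "(z, u) \<in> (adj_in A D)\<^sup>*" "(u, v) \<in> adj_in A D" "?l u = i"
        using lev_pred[of z v A D i] by (metis (no_types, lifting) Image_singleton_iff mem_Collect_eq)
      then have "u \<in> ?V" using Suc by auto
      then have "(z, u) \<in> (adj_in A ?V)\<^sup>*" using Suc.hyps(1) u(3) by simp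
      moreover have "(u, v) \<in> adj_in A ?V" using \<open>u \<in> ?V\<close> Suc.prems u(2) unfolding adj_in_def by auto
      ultimately show ?case by (rule rtrancl_into_rtrancl)
    qed
  qed
  have "anti A ?V ?C" unfolding anti_def using m by (auto dest!: close[rotated 2])
  moreover have "anti A (s ` ?C) ?C" unfolding anti_def
  proof (intro conjI ballI)
    show "s ` ?C \<inter> ?C = {}" using xs m by fastforce
  next
    fix u v assume "u \<in> s ` ?C" "v \<in> ?C"
    then have "u \<in> ?S" "?l u = Suc m" "v \<in> ?S" "?l v = Suc (Suc (Suc m))" using xs m by auto
    then show "\<not> A u v" using close[of u v] by auto
  qed
  moreover have "A y (x y) \<and> A (x y) (s y) \<and> touches A (s y) ?V \<and> x y \<in> D \<and> s y \<in> D \<and>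
            x y \<notin> ?C \<and> \<not> touches A (x y) ?V" if y: "y \<in> ?C" for y
  proof -
    note h = xs[OF y]
    have "\<not> A (x y) v" if "v \<in> ?V" for v
    proof
      assume "A (x y) v"
      then have "A v (x y)" using sym by (meson sympD)
      then show False using close[of v "x y"] that h by auto
    qed
    then show ?thesis using h m SD sym unfolding touches_def adj_in_def by (auto dest: sympD)
  qed
  ultimately have "bfs_cover A D ?V s x ?C"
    unfolding bfs_cover_def using V SD by auto
  then show thesis using that k by blast
qed

section \<open>Long chains from rich covers\<close>

text \<open>Raise a threshold \<open>t\<close> until the part of \<open>P\<close> or of
  \<open>Q\<close> with values at most \<open>t\<close> stops being \<open>c\<close>-colourable.
  Both parts with values below \<open>t\<close> are still \<open>c\<close>-colourable, so the other
  set stays large after its values below \<open>t\<close> are deleted.\<close>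

lemma split_one:
  fixes d :: "'a \<Rightarrow> nat"
  assumes fin: "finite P" and P: "\<not> col A P (c + c)" and Q: "\<not> col A Q (c + c)"
  shows "\<exists>P' Q'. P' \<subseteq> P \<and> Q' \<subseteq> Q \<and> \<not> col A P' c \<and> \<not> col A Q' c \<and>
    ((\<forall>p\<in>P'. \<forall>q\<in>Q'. d p \<le> d q) \<or> (\<forall>p\<in>P'. \<forall>q\<in>Q'. d q \<le> d p))"
proof -
  let ?le = "\<lambda>S t. {p \<in> S. d p \<le> t}" and ?lt = "\<lambda>S t. {p \<in> S. d p < t}"
  define big where "big t \<longleftrightarrow> \<not> col A (?le P t) c \<or> \<not> col A (?le Q t) c" for t
  have "?le P (Max (d ` P)) = P" using fin by auto
  moreover have "\<not> col A P c" using P col_mono[of A P c P "c + c"] by auto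
  ultimately have "big (Max (d ` P))" unfolding big_def by simp
  define t where "t = (LEAST t. big t)"
  have big: "big t" unfolding t_def using \<open>big (Max (d ` P))\<close> by (rule LeastI)
  have small: "col A (?lt P t) c \<and> col A (?lt Q t) c"
  proof (cases t)
    case 0
    then show ?thesis by (simp add: col_empty)
  next
    case (Suc t')
    then have "\<not> big t'" using not_less_Least[of t' big] unfolding t_def by simp
    then show ?thesis unfolding big_def Suc less_Suc_eq_le by simp
  qed
  have rest: "\<not> col A (P - ?lt P t) c" "\<not> col A (Q - ?lt Q t) c"
    using not_col_diff P Q small by blast+
  consider "\<not> col A (?le P t) c" | "\<not> col A (?le Q t) c"
    using big unfolding big_def by blast
  then show ?thesis
  proof cases
    case 1
    then show ?thesis using rest(2) by (intro exI[of _ "?le P t"] exI[of _ "Q - ?lt Q t"]) auto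
  next
    case 2
    then show ?thesis using rest(1) by (intro exI[of _ "P - ?lt P t"] exI[of _ "?le Q t"]) auto
  qed
qed

lemma split_all:
  fixes d :: "nat \<Rightarrow> 'a \<Rightarrow> nat"
  assumes "finite P" "\<not> col A P (2 ^ B * c)" "\<not> col A Q (2 ^ B * c)"
  shows "\<exists>P' Q'. P' \<subseteq> P \<and> Q' \<subseteq> Q \<and> \<not> col A P' c \<and> \<not> col A Q' c \<and>
    (\<forall>i<B. (\<forall>p\<in>P'. \<forall>q\<in>Q'. d i p \<le> d i q) \<or> (\<forall>p\<in>P'. \<forall>q\<in>Q'. d i q \<le> d i p))"
  using assms
proof (induction B arbitrary: P Q)
  case 0
  then show ?case by auto
next
  case (Suc B)
  have "2 ^ Suc B * c = 2 ^ B * c + 2 ^ B * c" by simp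
  then obtain P1 Q1 where 1: "P1 \<subseteq> P" "Q1 \<subseteq> Q" "\<not> col A P1 (2 ^ B * c)" "\<not> col A Q1 (2 ^ B * c)"
    "(\<forall>p\<in>P1. \<forall>q\<in>Q1. d B p \<le> d B q) \<or> (\<forall>p\<in>P1. \<forall>q\<in>Q1. d B q \<le> d B p)"
    using split_one[of P A "2 ^ B * c" Q "d B"] Suc.prems by metis
  obtain P2 Q2 where 2: "P2 \<subseteq> P1" "Q2 \<subseteq> Q1" "\<not> col A P2 c" "\<not> col A Q2 c"
    "\<forall>i<B. (\<forall>p\<in>P2. \<forall>q\<in>Q2. d i p \<le> d i q) \<or> (\<forall>p\<in>P2. \<forall>q\<in>Q2. d i q \<le> d i p)"
    using Suc.IH[of P1 Q1] 1 Suc.prems(1) finite_subset by metis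
  have "\<forall>i<Suc B. (\<forall>p\<in>P2. \<forall>q\<in>Q2. d i p \<le> d i q) \<or> (\<forall>p\<in>P2. \<forall>q\<in>Q2. d i q \<le> d i p)"
    using 1(5) 2(1,2,5) by (auto simp: less_Suc_eq subset_iff)
  then show ?case using 1 2 by (intro exI[of _ P2] exI[of _ Q2]) auto
qed

text \<open>Each of the \<open>2 * M\<close> functions favours one of two directions, so
  \<open>M\<close> of them agree; renaming makes \<open>P\<close> the side with the smaller values.
  Both sets are cut out of the same \<open>D\<close>.\<close>

lemma split_majority:
  fixes d :: "nat \<Rightarrow> 'a \<Rightarrow> nat"
  assumes "finite D" "\<not> col A D (2 ^ (2 * M) * c)"
  obtains P Q g where "P \<subseteq> D" "Q \<subseteq> D" "\<not> col A P c" "\<not> col A Q c" "inj_on g {..<M}"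
    "\<And>j. j < M \<Longrightarrow> g j < 2 * M" "\<And>j p q. j < M \<Longrightarrow> p \<in> P \<Longrightarrow> q \<in> Q \<Longrightarrow> d (g j) p \<le> d (g j) q"
proof -
  obtain P Q where PQ: "P \<subseteq> D" "Q \<subseteq> D" "\<not> col A P c" "\<not> col A Q c"
    "\<forall>i<2*M. (\<forall>p\<in>P. \<forall>q\<in>Q. d i p \<le> d i q) \<or> (\<forall>p\<in>P. \<forall>q\<in>Q. d i q \<le> d i p)"
    using split_all[OF assms assms(2), of d] by blast
  let ?I = "{i \<in> {..<2*M}. \<forall>p\<in>P. \<forall>q\<in>Q. d i p \<le> d i q}"
  let ?J = "{i \<in> {..<2*M}. \<forall>p\<in>P. \<forall>q\<in>Q. d i q \<le> d i p}"
  have "?I \<union> ?J = {..<2*M}" using PQ(5) by auto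
  then have "2 * M \<le> card ?I + card ?J" using card_Un_le[of ?I ?J] by simp
  then consider "M \<le> card ?I" | "M \<le> card ?J" by linarith
  then show thesis
  proof cases
    case 1
    then obtain g where "g ` {..<M} \<subseteq> ?I" "inj_on g {..<M}"
      using card_le_inj[of "{..<M}" ?I] by auto
    then show thesis using PQ by (intro that[of P Q g]) auto
  next
    case 2
    then obtain g where "g ` {..<M} \<subseteq> ?J" "inj_on g {..<M}"
      using card_le_inj[of "{..<M}" ?J] by auto
    then show thesis using PQ by (intro that[of Q P g]) auto
  qed
qed

section \<open>Shortest links through a connected set\<close>

definition gap :: "('a \<Rightarrow> 'a \<Rightarrow> bool) \<Rightarrow> 'a set \<Rightarrow> 'a \<Rightarrow> 'a \<Rightarrow> nat" where
  "gap A U p q =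
     (LEAST j. \<exists>a b. a \<in> U \<and> b \<in> U \<and> A p a \<and> A q b \<and> (a, b) \<in> adj_in A U ^^ j)"

text \<open>\<open>W\<close> consists of the vertices of a shortest walk in \<open>U\<close> from a
  neighbour of \<open>p\<close> to a neighbour of \<open>q\<close>. If \<open>r\<close> sees its
  \<open>i\<close>-th vertex, then \<open>gap A U p r\<close> is at most \<open>i\<close>; when
  \<open>r\<close> is no closer to \<open>p\<close> than \<open>q\<close> is, this forces
  \<open>i\<close> to be the last position. So \<open>r\<close> and \<open>q\<close> have a common
  neighbour, which is impossible for the far-apart vertices in the application.\<close>

lemma gap_link:
  assumes sym: "symp A" and "conn A U" "touches A p U" "touches A q U"
  obtains W where "W \<subseteq> U" "conn A W" "touches A p W" "touches A q W"
    "\<And>r. touches A r W \<Longrightarrow> gap A U p q \<le> gap A U p r \<Longrightarrow> \<exists>b. A q b \<and> A r b"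
proof -
  let ?P = "\<lambda>q j. \<exists>a b. a \<in> U \<and> b \<in> U \<and> A p a \<and> A q b \<and> (a, b) \<in> adj_in A U ^^ j"
  let ?j = "gap A U p q"
  have "\<exists>j. ?P q j" using assms(2-4) unfolding conn_def touches_def
    by (metis rtrancl_imp_relpow)
  then have "?P q ?j" unfolding gap_def by (rule LeastI_ex)
  then obtain a b where ab: "a \<in> U" "b \<in> U" "A p a" "A q b" "(a, b) \<in> adj_in A U ^^ ?j" by blast
  then obtain f where f: "f 0 = a" "f ?j = b" "\<forall>i<?j. (f i, f (Suc i)) \<in> adj_in A U"
    unfolding relpow_fun_conv by blast
  let ?W = "f ` {..?j}"
  have inU: "f i \<in> U" if "i \<le> ?j" for i
    using that f ab by (cases i) (auto simp: adj_in_def)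
  have reach: "(a, f i) \<in> adj_in A U ^^ i" if "i \<le> ?j" for i
    using that f unfolding relpow_fun_conv by (intro exI[of _ f]) auto
  have "(a, f i) \<in> (adj_in A ?W)\<^sup>*" if "i \<le> ?j" for i
    using that
  proof (induction i)
    case (Suc i)
    then have "(f i, f (Suc i)) \<in> adj_in A ?W" using f(3) unfolding adj_in_def by auto
    then show ?case using Suc by (auto intro: rtrancl_into_rtrancl)
  qed (simp add: f)
  then have "conn A ?W" by (intro conn_from_root[OF sym, of _ a]) auto
  moreover have "\<exists>b. A q b \<and> A r b" if r: "touches A r ?W" "?j \<le> gap A U p r" for r
  proof -
    obtain i where i: "i \<le> ?j" "A r (f i)" using r(1) unfolding touches_def by auto
    then have "?P r i" using ab reach inU by blast
    then have "gap A U p r \<le> i" unfolding gap_def by (rule Least_le)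
    then have "i = ?j" using i r(2) by simp
    then show ?thesis using i f ab by auto
  qed
  moreover have "touches A p ?W" unfolding touches_def using ab f by (intro bexI[of _ a]) force+
  moreover have "touches A q ?W" unfolding touches_def using ab f by (intro bexI[of _ b]) force+
  ultimately show thesis using inU by (intro that[of ?W]) auto
qed

text \<open>\<open>\<phi>\<close> measures "large": to be left with more than \<open>c\<close>
  colours, start with more than \<open>\<phi> c\<close>. It stays a parameter because its value
  comes out of the induction on the number of nested searches.\<close>

definition rich ::
    "('a \<Rightarrow> 'a \<Rightarrow> bool) \<Rightarrow> (nat \<Rightarrow> nat) \<Rightarrow> ('a \<Rightarrow> 'a) \<Rightarrow> 'a set \<Rightarrow> bool" where
  "rich A \<phi> x C \<longleftrightarrow> (\<forall>c D. D \<subseteq> C \<and> \<not> col A D (\<phi> c) \<longrightarrow>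
     (\<exists>U C'. U \<subseteq> D \<and> C' \<subseteq> D \<and> conn A U \<and> anti A U C' \<and> (\<forall>y\<in>C'. touches A (x y) U) \<and>
        \<not> col A C' c))"

lemma richD:
  assumes "rich A \<phi> x C" "D \<subseteq> C" "\<not> col A D (\<phi> c)"
  obtains U C' where "U \<subseteq> D" "C' \<subseteq> D" "conn A U" "anti A U C'" "\<forall>y\<in>C'. touches A (x y) U"
    "\<not> col A C' c"
proof -
  have "\<exists>U C'. U \<subseteq> D \<and> C' \<subseteq> D \<and> conn A U \<and> anti A U C' \<and> (\<forall>y\<in>C'. touches A (x y) U) \<and>
        \<not> col A C' c"
    using assms unfolding rich_def by simp
  then show thesis using that by (elim exE conjE)
qed

definition cover_block ::
    "('a \<Rightarrow> 'a \<Rightarrow> bool) \<Rightarrow> ('a \<Rightarrow> 'a) \<Rightarrow> nat \<Rightarrow> (nat \<Rightarrow> 'a set) \<Rightarrow> 'a set \<Rightarrow> bool" where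
  "cover_block A x B U D \<longleftrightarrow>
     (\<forall>i<B. conn A (U i) \<and> anti A (U i) D \<and> (\<forall>y\<in>D. touches A (x y) (U i))) \<and>
     (\<forall>i<B. \<forall>j<B. i \<noteq> j \<longrightarrow> anti A (U i) (U j))"

lemma cover_block_mono:
  assumes "cover_block A x B U D" "D' \<subseteq> D"
  shows "cover_block A x B U D'"
proof -
  have "anti A (U i) D'" if "i < B" for i
    using assms that anti_mono[of A "U i" D "U i" D'] unfolding cover_block_def by simp
  then show ?thesis using assms unfolding cover_block_def by auto
qed

text \<open>Richness is applied again inside the set that remains. Each new set lies in a remainder
  anticomplete to the earlier ones, which makes the whole block pairwise anticomplete.\<close>

lemma rich_cover_block:
  assumes "symp A" "rich A \<phi> x C" "D \<subseteq> C" "\<not> col A D ((\<phi> ^^ B) c)"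
  obtains U C' where "C' \<subseteq> D" "\<And>i. i < B \<Longrightarrow> U i \<subseteq> D" "cover_block A x B U C'" "\<not> col A C' c"
proof -
  have "\<exists>U C'. C' \<subseteq> D \<and> (\<forall>i<B. U i \<subseteq> D) \<and> cover_block A x B U C' \<and> \<not> col A C' c"
    using assms(3,4)
  proof (induction B arbitrary: D)
    case 0
    then show ?case unfolding cover_block_def by (intro exI[of _ "\<lambda>_. {}"] exI[of _ D]) auto
  next
    case (Suc B)
    have "\<not> col A D (\<phi> ((\<phi> ^^ B) c))" using Suc.prems(2) by simp
    then obtain U0 D1 where 1: "U0 \<subseteq> D" "D1 \<subseteq> D" "conn A U0" "anti A U0 D1"
      "\<forall>y\<in>D1. touches A (x y) U0" "\<not> col A D1 ((\<phi> ^^ B) c)"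
      by (rule richD[OF assms(2) Suc.prems(1)])
    have "D1 \<subseteq> C" using 1(2) Suc.prems(1) by simp
    from Suc.IH[OF this 1(6)]
    obtain U C' where 2: "C' \<subseteq> D1" "\<forall>i<B. U i \<subseteq> D1" "cover_block A x B U C'" "\<not> col A C' c"
      by (elim exE conjE)
    let ?U = "U(B := U0)"
    have U0: "anti A U0 (U i)" if "i < B" for i
      by (rule anti_mono[OF 1(4)]) (use 2(2) that in auto)
    then have U0': "anti A (U i) U0" if "i < B" for i
      using that anti_sym[OF assms(1)] by blast
    have "anti A U0 C'" by (rule anti_mono[OF 1(4)]) (use 2(1) in auto)
    then have "cover_block A x (Suc B) ?U C'"
      using 1(3,5) 2(1,3) U0 U0' unfolding cover_block_def less_Suc_eq by auto
    moreover have "U i \<subseteq> D" if "i < B" for i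
      using 1(2) 2(2) that order_trans[of "U i" D1 D] by simp
    then have "C' \<subseteq> D" "\<forall>i<Suc B. ?U i \<subseteq> D"
      using 1(1,2) 2(1) by (auto simp: less_Suc_eq)
    ultimately show ?case using 2(4) by blast
  qed
  then show thesis using that by blast
qed

section \<open>Chains of parallel links between parents\<close>

definition fat_chain ::
    "('a \<Rightarrow> 'a \<Rightarrow> bool) \<Rightarrow> ('a \<Rightarrow> 'a) \<Rightarrow> nat \<Rightarrow> nat \<Rightarrow> nat \<Rightarrow> (nat \<Rightarrow> 'a) \<Rightarrow> (nat \<Rightarrow> nat \<Rightarrow> 'a set) \<Rightarrow> bool"
  where
  "fat_chain A x \<rho> M m u W \<longleftrightarrow>
     (\<forall>a\<le>m. \<forall>b\<le>m. a \<noteq> b \<longrightarrow> \<not> near A \<rho> (u a) (u b)) \<and>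
     (\<forall>a<m. \<forall>j<M. conn A (W a j) \<and>
        (\<forall>b\<le>m. touches A (x (u b)) (W a j) \<longleftrightarrow> b = a \<or> b = Suc a)) \<and>
     (\<forall>a<m. \<forall>a'<m. \<forall>j<M. \<forall>j'<M. (a, j) \<noteq> (a', j') \<longrightarrow> anti A (W a j) (W a' j'))"

lemma near_two_step:
  assumes "symp A" "A y p" "A z q" "near A r p q"
  shows "near A (Suc (Suc r)) y z"
proof -
  have "near A (Suc 0) y p" using assms(2) by (rule near_adj)
  then have "near A (Suc 0 + r) y q" using assms(4) by (rule near_trans)
  moreover have "near A (Suc 0) q z" using assms(1,3) near_adj by (metis sympD)
  ultimately show ?thesis using near_trans by fastforce
qed

text \<open>The state of the induction. The block \<open>U\<close> was built before \<open>v\<close>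
  was chosen, so it is attached to the parent of \<open>v\<close> and to the parent of every
  candidate in \<open>D\<close>; the links from \<open>x v\<close> to the next branch vertex will
  run through it.\<close>

definition chain_start ::
    "('a \<Rightarrow> 'a \<Rightarrow> bool) \<Rightarrow> ('a \<Rightarrow> 'a) \<Rightarrow> nat \<Rightarrow> nat \<Rightarrow> nat \<Rightarrow> (nat \<Rightarrow> nat) \<Rightarrow> 'a set \<Rightarrow> 'a \<Rightarrow> 'a set \<Rightarrow>
     (nat \<Rightarrow> 'a set) \<Rightarrow> bool" where
  "chain_start A x \<tau> \<rho> M \<phi> C v D U \<longleftrightarrow>
     locally_col A \<tau> \<rho> \<and> finite C \<and> rich A \<phi> x C \<and> (\<forall>y\<in>C. A y (x y)) \<and> v \<in> C \<and> D \<subseteq> C \<and>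
     cover_block A x (2 * M) U (insert v D) \<and> (\<forall>y\<in>D. \<not> near A \<rho> v y)"

text \<open>Only the first links may use the old block \<open>U\<close>. Keeping everything else in
  \<open>D\<close> is what separates it from whatever was built earlier.\<close>

definition chain_extends ::
    "('a \<Rightarrow> 'a \<Rightarrow> bool) \<Rightarrow> ('a \<Rightarrow> 'a) \<Rightarrow> nat \<Rightarrow> nat \<Rightarrow> nat \<Rightarrow> 'a \<Rightarrow> 'a set \<Rightarrow> (nat \<Rightarrow> 'a set) \<Rightarrow> bool" where
  "chain_extends A x \<rho> M m v D U \<longleftrightarrow>
     (\<exists>u W. fat_chain A x \<rho> M m u W \<and> u 0 = v \<and> (\<forall>a\<le>m. 0 < a \<longrightarrow> u a \<in> D) \<and>
       (\<forall>a<m. \<forall>j<M. W a j \<subseteq> (if a = 0 then \<Union>i<2*M. U i else D)))"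

text \<open>The induction prepends: choose the second branch vertex \<open>v'\<close> and the links
  to it from \<open>x v\<close>, then let the hypothesis continue from \<open>v'\<close> with a
  fresh block. \<open>K\<close> precedes \<open>A\<close> in the quantifiers, so it is uniform over
  all graphs.\<close>

lemma exists_fat_chain:
  assumes \<rho>: "4 \<le> \<rho>"
  shows "\<exists>K. \<forall>A (x :: 'a \<Rightarrow> 'a) C v D U.
    chain_start A x \<tau> \<rho> M \<phi> C v D U \<and> \<not> col A D K \<longrightarrow> chain_extends A x \<rho> M m v D U"
proof (induction m)
  case 0
  have "chain_extends A x \<rho> M 0 v D U" for A and x :: "'a \<Rightarrow> 'a" and v D U
    unfolding chain_extends_def fat_chain_def by (intro exI[of _ "\<lambda>_. v"]) auto
  then show ?case by blast
next
  case (Suc m)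
  then obtain K where K: "\<And>A (x :: 'a \<Rightarrow> 'a) C v D U.
    chain_start A x \<tau> \<rho> M \<phi> C v D U \<Longrightarrow> \<not> col A D K \<Longrightarrow> chain_extends A x \<rho> M m v D U"
    by metis
  show ?case
  \<comment> \<open>From the inside out: \<open>K\<close> for the recursive call,
    \<open>\<tau>\<close> for the ball around \<open>v'\<close>, a factor 2 for comparing gaps in
    each of the \<open>2 * M\<close> old sets, and one application of \<open>\<phi>\<close> for each
    of the \<open>2 * M\<close> new sets.\<close>
  proof (intro exI[of _ "(\<phi> ^^ (2 * M)) (2 ^ (2 * M) * (K + \<tau>))"] allI impI, elim conjE)
    fix A and x :: "'a \<Rightarrow> 'a" and C v D U
    assume start: "chain_start A x \<tau> \<rho> M \<phi> C v D U"
      and big: "\<not> col A D ((\<phi> ^^ (2 * M)) (2 ^ (2 * M) * (K + \<tau>)))"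
    have loc: "locally_col A \<tau> \<rho>" and fin: "finite C" and rich: "rich A \<phi> x C"
      and x: "\<forall>y\<in>C. A y (x y)" and v: "v \<in> C" and D: "D \<subseteq> C"
      and U: "cover_block A x (2 * M) U (insert v D)" and far: "\<forall>y\<in>D. \<not> near A \<rho> v y"
      using start unfolding chain_start_def by blast+
    have sym: "symp A" using loc unfolding locally_col_def by blast
    obtain U' C' where U': "C' \<subseteq> D" "\<And>i. i < 2 * M \<Longrightarrow> U' i \<subseteq> D" "cover_block A x (2 * M) U' C'"
      and C': "\<not> col A C' (2 ^ (2 * M) * (K + \<tau>))"
      using rich_cover_block[OF sym rich D big] by metis
    have "finite C'" using U'(1) D fin by (meson finite_subset)
    then obtain P Q g where PQ: "P \<subseteq> C'" "Q \<subseteq> C'" "\<not> col A P (K + \<tau>)" "\<not> col A Q (K + \<tau>)"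
      and g: "inj_on g {..<M}" "\<And>j. j < M \<Longrightarrow> g j < 2 * M"
        "\<And>j p q. j < M \<Longrightarrow> p \<in> P \<Longrightarrow> q \<in> Q \<Longrightarrow>
           gap A (U (g j)) (x v) (x p) \<le> gap A (U (g j)) (x v) (x q)"
      using split_majority[OF _ C', of "\<lambda>i y. gap A (U i) (x v) (x y)"] by metis
    obtain v' where v': "v' \<in> P" using PQ(3) by (rule not_col_obtains)
    \<comment> \<open>\<open>v'\<close> comes from the near side \<open>P\<close> and all later
      vertices from the far side \<open>Q\<close>; this is the inequality that
      \<open>gap_link\<close> needs.\<close>
    define D' where "D' = Q - {y. near A \<rho> v' y}"
    have D': "D' \<subseteq> Q" "D' \<subseteq> C'" "D' \<subseteq> D" "v' \<in> C'" "v' \<in> D"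
      using v' PQ U'(1) unfolding D'_def by auto
    have far': "\<forall>y\<in>D'. \<not> near A \<rho> v' y" unfolding D'_def by blast
    have "cover_block A x (2 * M) U' (insert v' D')"
      by (rule cover_block_mono[OF U'(3)]) (use D' in auto)
    then have "chain_start A x \<tau> \<rho> M \<phi> C v' D' U'"
      unfolding chain_start_def using loc fin rich x D D' far' by blast
    moreover have "\<not> col A D' K"
      unfolding D'_def using not_col_diff[OF PQ(4) locally_colD(3)[OF loc]] .
    ultimately have "chain_extends A x \<rho> M m v' D' U'" by (rule K)
    then obtain u W where uW: "fat_chain A x \<rho> M m u W" "u 0 = v'"
      "\<forall>a\<le>m. 0 < a \<longrightarrow> u a \<in> D'" "\<forall>a<m. \<forall>j<M. W a j \<subseteq> (if a = 0 then \<Union>i<2*M. U' i else D')"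
      unfolding chain_extends_def by blast
    have W_D: "W a j \<subseteq> D" if "a < m" "j < M" for a j
    proof -
      have "W a j \<subseteq> (if a = 0 then \<Union>i<2*M. U' i else D')" using uW(4) that by blast
      also have "\<dots> \<subseteq> D" using U'(2) D'(3) by (simp add: UN_subset_iff)
      finally show ?thesis .
    qed
    \<comment> \<open>A neighbour of \<open>x v\<close> in \<open>D\<close> would be at distance at
      most 2 from \<open>v\<close>, but \<open>D\<close> avoids the ball around \<open>v\<close>.
      Hence \<open>x v\<close> sees none of the later links.\<close>
    have xv: "\<not> touches A (x v) S" if "S \<subseteq> D" for S
    proof
      assume "touches A (x v) S"
      then have "touches A (x v) D" using \<open>S \<subseteq> D\<close> by (rule touches_mono)
      then obtain y where y: "y \<in> D" "A (x v) y" unfolding touches_def by blast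
      have "near A (Suc 0 + Suc 0) v y" using x v y near_adj near_trans by metis
      then have "near A \<rho> v y" by (rule near_mono) (use \<rho> in simp)
      then show False using far y by blast
    qed
    have "\<exists>W0. W0 \<subseteq> U (g j) \<and> conn A W0 \<and> touches A (x v) W0 \<and> touches A (x v') W0 \<and>
      (\<forall>y\<in>D'. \<not> touches A (x y) W0)" if j: "j < M" for j
    proof -
      have "conn A (U (g j))" "touches A (x v) (U (g j))" "touches A (x v') (U (g j))"
        using U g(2)[OF j] D'(5) unfolding cover_block_def by auto
      then obtain W0 where W0: "W0 \<subseteq> U (g j)" "conn A W0" "touches A (x v) W0" "touches A (x v') W0"
        "\<And>r. touches A r W0 \<Longrightarrow> gap A (U (g j)) (x v) (x v') \<le> gap A (U (g j)) (x v) r \<Longrightarrow>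
            \<exists>b. A (x v') b \<and> A r b"
        using gap_link[OF sym] by metis
      \<comment> \<open>A common neighbour of \<open>x v'\<close> and \<open>x y\<close> puts
        \<open>y\<close> within distance 4 of \<open>v'\<close>; the bound
        \<open>4 \<le> \<rho>\<close> excludes this.\<close>
      have "\<not> touches A (x y) W0" if y: "y \<in> D'" for y
      proof
        assume "touches A (x y) W0"
        moreover have "gap A (U (g j)) (x v) (x v') \<le> gap A (U (g j)) (x v) (x y)"
          using g(3)[OF j v'] y D'(1) by blast
        ultimately obtain b where b: "A (x v') b" "A (x y) b" using W0(5) by blast
        have "near A (Suc (Suc 0)) (x v') (x y)" using near_two_step[OF sym b near_refl] .
        then have "near A (Suc (Suc (Suc (Suc 0)))) v' y"
          using near_two_step[OF sym] x D' D y by (meson subsetD)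
        then have "near A \<rho> v' y" by (rule near_mono) (use \<rho> in simp)
        then show False using far' y by blast
      qed
      then show ?thesis using W0 by blast
    qed
    then obtain W0 where W0: "\<And>j. j < M \<Longrightarrow> W0 j \<subseteq> U (g j) \<and> conn A (W0 j) \<and>
        touches A (x v) (W0 j) \<and> touches A (x v') (W0 j) \<and> (\<forall>y\<in>D'. \<not> touches A (x y) (W0 j))"
      by metis
    \<comment> \<open>\<open>case_nat\<close> puts \<open>v\<close> and its links in front and
      shifts the recursive chain by one.\<close>
    define u' where "u' = case_nat v u"
    define W' where "W' = case_nat W0 W"
    have [simp]: "u' 0 = v" "u' (Suc a) = u a" "W' 0 = W0" "W' (Suc a) = W a" for a
      unfolding u'_def W'_def by simp_all
    have u_D: "u a \<in> D" if "a \<le> m" for a using uW(2,3) D' that by (cases "a = 0") auto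
    have "\<not> near A \<rho> (u' a) (u' b)" if "a \<le> Suc m" "b \<le> Suc m" "a \<noteq> b" for a b
      using that uW(1) far u_D near_sym[OF sym, of \<rho> _ v] unfolding fat_chain_def
      by (cases a; cases b) auto
    moreover have "conn A (W' a j) \<and>
        (\<forall>b\<le>Suc m. touches A (x (u' b)) (W' a j) \<longleftrightarrow> b = a \<or> b = Suc a)"
      if "a < Suc m" "j < M" for a j
    proof (cases a)
      case 0
      have "touches A (x (u' b)) (W0 j) \<longleftrightarrow> b = 0 \<or> b = Suc 0" if b: "b \<le> Suc m" for b
      proof -
        consider "b = 0" | "b = Suc 0" | c where "b = Suc c" "0 < c" "c \<le> m"
          using b by (cases b; cases "b - 1") auto
        then show ?thesis using W0[OF \<open>j < M\<close>] uW(2,3) by cases auto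
      qed
      then show ?thesis using W0[OF \<open>j < M\<close>] 0 by simp
    next
      case (Suc a')
      then have "a' < m" using that by simp
      then have "conn A (W a' j)" "\<forall>b\<le>m. touches A (x (u b)) (W a' j) \<longleftrightarrow> b = a' \<or> b = Suc a'"
        using uW(1) that(2) unfolding fat_chain_def by blast+
      moreover have "\<not> touches A (x v) (W a' j)" using xv W_D \<open>a' < m\<close> that(2) by blast
      ultimately have "touches A (x (u' b)) (W a' j) \<longleftrightarrow> b = Suc a' \<or> b = Suc (Suc a')"
        if "b \<le> Suc m" for b
        using that by (cases b) auto
      then show ?thesis using Suc \<open>conn A (W a' j)\<close> by simp
    qed
    moreover have "anti A (W' a j) (W' a' j')"
      if "a < Suc m" "a' < Suc m" "j < M" "j' < M" "(a, j) \<noteq> (a', j')" for a a' j j'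
    proof -
      \<comment> \<open>The recursive links lie in \<open>D\<close>, which is anticomplete to the
        old block.\<close>
      have U_D: "anti A (W0 i) (W b i')" "anti A (W b i') (W0 i)" if "i < M" "i' < M" "b < m" for i i' b
      proof -
        have "anti A (U (g i)) (insert v D)" using U g(2)[OF that(1)] unfolding cover_block_def by blast
        then show "anti A (W0 i) (W b i')"
          by (rule anti_mono) (use W0[OF that(1)] W_D that in auto)
        then show "anti A (W b i') (W0 i)" using anti_sym[OF sym] by blast
      qed
      have 0: "anti A (W0 j) (W0 j')" if "j \<noteq> j'"
      proof -
        have "g j \<noteq> g j'" using g(1) \<open>j < M\<close> \<open>j' < M\<close> that by (auto dest: inj_onD)
        then have "anti A (U (g j)) (U (g j'))"
          using U g(2) \<open>j < M\<close> \<open>j' < M\<close> unfolding cover_block_def by blast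
        then show ?thesis by (rule anti_mono) (use W0 \<open>j < M\<close> \<open>j' < M\<close> in auto)
      qed
      have "anti A (W b j) (W b' j')" if "b < m" "b' < m" "(b, j) \<noteq> (b', j')" for b b'
        using uW(1) that \<open>j < M\<close> \<open>j' < M\<close> unfolding fat_chain_def by blast
      then show ?thesis using that U_D 0 by (cases a; cases a') auto
    qed
    ultimately have "fat_chain A x \<rho> M (Suc m) u' W'" unfolding fat_chain_def by blast
    moreover have "\<forall>a\<le>Suc m. 0 < a \<longrightarrow> u' a \<in> D" using u_D by (auto simp: gr0_conv_Suc)
    moreover have "\<forall>a<Suc m. \<forall>j<M. W' a j \<subseteq> (if a = 0 then \<Union>i<2*M. U i else D)"
    proof (intro allI impI)
      fix a j assume "a < Suc m" "j < M"
      then show "W' a j \<subseteq> (if a = 0 then \<Union>i<2*M. U i else D)"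
        using W0[of j] g(2)[of j] W_D by (cases a) auto
    qed
    ultimately show "chain_extends A x \<rho> M (Suc m) v D U"
      unfolding chain_extends_def by (intro exI[of _ u'] exI[of _ W']) simp
  qed
qed

section \<open>Fat cycles\<close>

text \<open>A model places the vertices of a multigraph far apart and represents each edge by a connected
  set that sees exactly the two ends of the edge; shortest paths through these sets form an
  induced subdivision.\<close>

definition link_model ::
    "('a \<Rightarrow> 'a \<Rightarrow> bool) \<Rightarrow> 'v set \<Rightarrow> 'e set \<Rightarrow> ('e \<Rightarrow> 'v set) \<Rightarrow> nat \<Rightarrow> ('v \<Rightarrow> 'a) \<Rightarrow> ('e \<Rightarrow> 'a set) \<Rightarrow> bool"
  where
  "link_model A VS ES ends L w W \<longleftrightarrow>
     (\<forall>a\<in>VS. \<forall>b\<in>VS. a \<noteq> b \<longrightarrow> \<not> near A L (w a) (w b)) \<and>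
     (\<forall>e\<in>ES. conn A (W e) \<and>
        (\<forall>b\<in>VS. w b \<notin> W e \<and> (touches A (w b) (W e) \<longleftrightarrow> b \<in> ends e))) \<and>
     (\<forall>e\<in>ES. \<forall>f\<in>ES. e \<noteq> f \<longrightarrow> anti A (W e) (W f))"

text \<open>For \<open>a < m\<close> the pair \<open>(a, j)\<close> is the \<open>j\<close>-th
  parallel edge from \<open>a\<close> to \<open>Suc a\<close>. The pair \<open>(m, 0)\<close> is the
  edge that is not fattened, closing the cycle of \<open>m + 1\<close> vertices from
  \<open>m\<close> to \<open>0\<close>.\<close>

definition fat_cycle_edges :: "nat \<Rightarrow> nat \<Rightarrow> (nat \<times> nat) set" where
  "fat_cycle_edges m M = insert (m, 0) ({..<m} \<times> {..<M})"

definition fat_cycle_ends :: "nat \<Rightarrow> nat \<times> nat \<Rightarrow> nat set" where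
  "fat_cycle_ends m e = {fst e, if fst e = m then 0 else Suc (fst e)}"

definition has_fat_cycle :: "('a \<Rightarrow> 'a \<Rightarrow> bool) \<Rightarrow> nat \<Rightarrow> nat \<Rightarrow> nat \<Rightarrow> bool" where
  "has_fat_cycle A m M L \<longleftrightarrow>
     (\<exists>w W. link_model A {..m} (fat_cycle_edges m M) (fat_cycle_ends m) L w W)"

section \<open>The rich case: closing a chain to a fat cycle\<close>

lemma conn_attach:
  assumes sym: "symp A" and V: "conn A V" and S: "\<And>v. v \<in> S \<Longrightarrow> touches A v V"
  shows "conn A (V \<union> S)"
proof (cases "V = {}")
  case True
  then have "S = {}" using S unfolding touches_def by blast
  then show ?thesis using V by simp
next
  case False
  then obtain z where z: "z \<in> V" by blast
  have V': "(z, v) \<in> (adj_in A (V \<union> S))\<^sup>*" if "v \<in> V" for v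
  proof -
    have "(z, v) \<in> (adj_in A V)\<^sup>*" using V z that unfolding conn_def by blast
    then show ?thesis using rtrancl_mono[OF adj_in_mono[of V "V \<union> S" A]] by blast
  qed
  have "(z, v) \<in> (adj_in A (V \<union> S))\<^sup>*" if v: "v \<in> S" for v
  proof -
    obtain u where u: "u \<in> V" "A v u" using S[OF v] unfolding touches_def by blast
    then have "(u, v) \<in> adj_in A (V \<union> S)" using sym v unfolding adj_in_def by (auto dest: sympD)
    then show ?thesis using V'[OF u(1)] by (rule rtrancl_into_rtrancl[rotated])
  qed
  then show ?thesis using V' by (intro conn_from_root[OF sym, of _ z]) blast
qed

lemma touches_Un: "touches A v (S \<union> T) \<longleftrightarrow> touches A v S \<or> touches A v T"
  unfolding touches_def by blast

lemma touches_anti: "symp A \<Longrightarrow> anti A S T \<Longrightarrow> v \<in> T \<Longrightarrow> \<not> touches A v S"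
  unfolding anti_def touches_def by (meson sympD)

lemma anti_UnI: "anti A S T \<Longrightarrow> anti A S' T \<Longrightarrow> anti A (S \<union> S') T"
  unfolding anti_def by blast

text \<open>The branch vertices are parents \<open>x (u a)\<close>. Each is one step from
  \<open>u a\<close>, so their pairwise distances may be smaller by 2 than those of the
  \<open>u a\<close>; hence the radius \<open>\<rho> - 2\<close>.\<close>

lemma rich_has_fat_cycle:
  assumes \<rho>: "4 \<le> \<rho>"
  shows "\<exists>K. \<forall>A D V s (x :: 'a \<Rightarrow> 'a) C. locally_col A \<tau> \<rho> \<longrightarrow> finite C \<longrightarrow> rich A \<phi> x C \<longrightarrow>
    bfs_cover A D V s x C \<longrightarrow> \<not> col A C K \<longrightarrow> has_fat_cycle A m M (\<rho> - 2)"
proof -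
  obtain K where K: "\<And>A (x :: 'a \<Rightarrow> 'a) C v D U.
    chain_start A x \<tau> \<rho> M \<phi> C v D U \<Longrightarrow> \<not> col A D K \<Longrightarrow> chain_extends A x \<rho> M m v D U"
    using exists_fat_chain[OF \<rho>] by metis
  show ?thesis
  proof (intro exI[of _ "(\<phi> ^^ (2 * M)) (K + \<tau>)"] allI impI)
    fix A and x :: "'a \<Rightarrow> 'a" and D V s C
    assume loc: "locally_col A \<tau> \<rho>" and fin: "finite C" and rich: "rich A \<phi> x C"
      and bfs: "bfs_cover A D V s x C" and big: "\<not> col A C ((\<phi> ^^ (2 * M)) (K + \<tau>))"
    have sym: "symp A" using loc unfolding locally_col_def by blast
    have V: "conn A V" "anti A V C" "anti A (s ` C) C"
      and bfs: "\<And>y. y \<in> C \<Longrightarrow> A y (x y) \<and> A (x y) (s y) \<and> touches A (s y) V \<and> x y \<notin> C \<and>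
        \<not> touches A (x y) V"
      using bfs unfolding bfs_cover_def by auto
    obtain U C' where U: "C' \<subseteq> C" "\<And>i. i < 2 * M \<Longrightarrow> U i \<subseteq> C" "cover_block A x (2 * M) U C'"
      and C': "\<not> col A C' (K + \<tau>)"
      using rich_cover_block[OF sym rich order_refl big] by metis
    obtain v where v: "v \<in> C'" using C' by (rule not_col_obtains)
    let ?D = "C' - {y. near A \<rho> v y}"
    have "cover_block A x (2 * M) U (insert v ?D)"
      by (rule cover_block_mono[OF U(3)]) (use v in auto)
    then have "chain_start A x \<tau> \<rho> M \<phi> C v ?D U"
      unfolding chain_start_def using loc fin rich bfs v U(1) by auto
    moreover have "\<not> col A ?D K"
      using not_col_diff[OF C' locally_colD(3)[OF loc]] .
    ultimately have "chain_extends A x \<rho> M m v ?D U" by (rule K)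
    then obtain u W where uW: "fat_chain A x \<rho> M m u W" "u 0 = v" "\<forall>a\<le>m. 0 < a \<longrightarrow> u a \<in> ?D"
      "\<forall>a<m. \<forall>j<M. W a j \<subseteq> (if a = 0 then \<Union>i<2*M. U i else ?D)"
      unfolding chain_extends_def by blast
    have W: "conn A (W a j)" "\<And>b. b \<le> m \<Longrightarrow> touches A (x (u b)) (W a j) \<longleftrightarrow> b = a \<or> b = Suc a"
      if "a < m" "j < M" for a j
      using uW(1) that unfolding fat_chain_def by blast+
    have W_anti: "anti A (W a j) (W a' j')"
      if "a < m" "a' < m" "j < M" "j' < M" "(a, j) \<noteq> (a', j')" for a a' j j'
      using uW(1) that unfolding fat_chain_def by blast
    have far: "\<not> near A \<rho> (u a) (u b)" if "a \<le> m" "b \<le> m" "a \<noteq> b" for a b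
      using uW(1) that unfolding fat_chain_def by blast
    have far': "\<not> near A r (u a) (u b)" if "r \<le> 4" "a \<le> m" "b \<le> m" "a \<noteq> b" for a b r
      using far[OF that(2-4)] near_mono[of A r "u a" "u b" \<rho>] that(1) \<rho> by auto
    have u: "u a \<in> C" if "a \<le> m" for a
      using uW(2,3) v U(1) that by (cases "a = 0") auto
    have W_C: "W a j \<subseteq> C" if "a < m" "j < M" for a j
    proof -
      have "W a j \<subseteq> (if a = 0 then \<Union>i<2*M. U i else ?D)" using uW(4) that by blast
      also have "\<dots> \<subseteq> C" using U(1,2) by (auto simp: UN_subset_iff)
      finally show ?thesis .
    qed
    \<comment> \<open>No parent sees \<open>V\<close>, so adding the grandparents of the two end
      vertices attaches exactly the parents of these two.\<close>
    define Z where "Z = V \<union> {s (u 0), s (u m)}"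
    have Z_anti: "anti A Z C"
      unfolding Z_def by (rule anti_UnI[OF V(2)], rule anti_mono[OF V(3)]) (use u in auto)
    define W' where "W' e = (if fst e = m then Z else W (fst e) (snd e))" for e
    define w where "w a = x (u a)" for a
    \<comment> \<open>If a parent coincided with or saw the grandparent of another branch vertex,
      then \<open>u a\<close> and \<open>u b\<close> would be within distance 4.\<close>
    have x_s: "x (u b) \<noteq> s (u a)" "A (x (u b)) (s (u a)) \<longleftrightarrow> b = a" if "a \<le> m" "b \<le> m" for a b
    proof -
      have 1: "near A (Suc 0) (x (u a)) (s (u a))" using bfs[OF u] that by (intro near_adj) blast
      have n: "near A (Suc (Suc r)) (u a) (u b)" if "near A r (x (u a)) (x (u b))" for r
        using near_two_step[OF sym _ _ that] bfs[OF u] \<open>a \<le> m\<close> \<open>b \<le> m\<close> by blast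
      show "x (u b) \<noteq> s (u a)"
      proof
        assume eq: "x (u b) = s (u a)"
        show False
        proof (cases "a = b")
          case True
          then show False using eq bfs[OF u[OF that(1)]] locally_colD(2)[OF loc] by metis
        next
          case False
          then show False using n[of "Suc 0"] 1 eq far'[of "Suc (Suc (Suc 0))" a b] that by auto
        qed
      qed
      show "A (x (u b)) (s (u a)) \<longleftrightarrow> b = a"
      proof
        assume "A (x (u b)) (s (u a))"
        then have "near A (Suc 0 + Suc 0) (x (u a)) (x (u b))"
          using near_trans[OF 1] near_adj locally_colD(1)[OF loc] by metis
        then have "near A (Suc (Suc (Suc (Suc 0)))) (u a) (u b)" using n by fastforce
        then show "b = a" using far'[of "Suc (Suc (Suc (Suc 0)))" a b] that by auto
      qed (use bfs[OF u] that in blast)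
    qed
    have "x (u b) \<notin> Z" if "b \<le> m" for b
    proof -
      have "A (x (u b)) (u b)" using bfs[OF u[OF that]] locally_colD(1)[OF loc] by blast
      then have "x (u b) \<notin> V" using V(2) u[OF that] unfolding anti_def by blast
      then show ?thesis using x_s(1) that unfolding Z_def by auto
    qed
    moreover have "touches A (x (u b)) Z \<longleftrightarrow> b \<in> {m, 0}" if "b \<le> m" for b
    proof -
      have "\<not> touches A (x (u b)) V" using bfs[OF u[OF that]] by blast
      then show ?thesis using x_s(2) that unfolding Z_def touches_Un by (auto simp: touches_def)
    qed
    moreover have "conn A Z"
      unfolding Z_def by (rule conn_attach[OF sym V(1)]) (use bfs u in auto)
    ultimately have Z: "conn A Z \<and> (\<forall>b\<le>m. w b \<notin> Z \<and> (touches A (w b) Z \<longleftrightarrow> b \<in> {m, 0}))"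
      unfolding w_def by blast
    have "\<not> near A (\<rho> - 2) (w a) (w b)" if "a \<le> m" "b \<le> m" "a \<noteq> b" for a b
    proof
      assume "near A (\<rho> - 2) (w a) (w b)"
      then have "near A (Suc (Suc (\<rho> - 2))) (u a) (u b)"
        unfolding w_def using near_two_step[OF sym] bfs u that by metis
      then show False using far[OF that] \<rho> by (simp add: numeral_2_eq_2 Suc_diff_Suc)
    qed
    moreover have "conn A (W' e) \<and> (\<forall>b\<in>{..m}. w b \<notin> W' e \<and>
        (touches A (w b) (W' e) \<longleftrightarrow> b \<in> fat_cycle_ends m e))" if e: "e \<in> fat_cycle_edges m M" for e
    proof (cases "fst e = m")
      case True
      then show ?thesis using Z unfolding W'_def fat_cycle_ends_def by auto
    next
      case False
      then have a: "fst e < m" "snd e < M" using e unfolding fat_cycle_edges_def by auto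
      have "w b \<notin> W (fst e) (snd e)" if "b \<le> m" for b
        using W_C[OF a] bfs[OF u[OF that]] unfolding w_def by blast
      then show ?thesis using W[OF a] False unfolding W'_def fat_cycle_ends_def w_def by auto
    qed
    moreover have "anti A (W' e) (W' f)"
      if e: "e \<in> fat_cycle_edges m M" and f: "f \<in> fat_cycle_edges m M" and ef: "e \<noteq> f" for e f
    proof -
      have *: "anti A Z (W (fst g) (snd g))" if "g \<in> fat_cycle_edges m M" "fst g \<noteq> m" for g
        by (rule anti_mono[OF Z_anti order_refl W_C])
           (use that in \<open>auto simp: fat_cycle_edges_def\<close>)
      have one: "\<not> (fst e = m \<and> fst f = m)" using e f ef unfolding fat_cycle_edges_def by auto
      consider "fst e = m" "fst f \<noteq> m" | "fst e \<noteq> m" "fst f = m" | "fst e \<noteq> m" "fst f \<noteq> m"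
        using one by blast
      then show ?thesis
      proof cases
        case 1
        then show ?thesis unfolding W'_def using *[OF f] by simp
      next
        case 2
        then show ?thesis unfolding W'_def using anti_sym[OF sym *[OF e]] by simp
      next
        case 3
        then show ?thesis unfolding W'_def
          using W_anti[of "fst e" "fst f" "snd e" "snd f"] e f ef
          by (auto simp: fat_cycle_edges_def)
      qed
    qed
    ultimately have "link_model A {..m} (fat_cycle_edges m M) (fat_cycle_ends m) (\<rho> - 2) w W'"
      unfolding link_model_def by simp
    then show "has_fat_cycle A m M (\<rho> - 2)" unfolding has_fat_cycle_def by blast
  qed
qed

section \<open>Nested searches when no level is rich\<close>

definition cover_system ::
    "('a \<Rightarrow> 'a \<Rightarrow> bool) \<Rightarrow> nat \<Rightarrow> 'a set \<Rightarrow> (nat \<Rightarrow> 'a set) \<Rightarrow> (nat \<Rightarrow> 'a \<Rightarrow> 'a) \<Rightarrow> 'a set \<Rightarrow> bool" where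
  "cover_system A N D U x C \<longleftrightarrow> C \<subseteq> D \<and>
     (\<forall>i<N. U i \<subseteq> D \<and> conn A (U i) \<and> anti A (U i) C \<and> (\<forall>y\<in>C. A y (x i y) \<and> x i y \<in> D)) \<and>
     (\<forall>i<N. \<forall>j<N. \<forall>y\<in>C. touches A (x i y) (U j) \<longleftrightarrow> i = j) \<and>
     (\<forall>i<N. \<forall>j<N. i \<noteq> j \<longrightarrow> anti A (U i) (U j))"

lemma cover_systemD:
  assumes "cover_system A N D U x C"
  shows "C \<subseteq> D" "i < N \<Longrightarrow> U i \<subseteq> D" "i < N \<Longrightarrow> conn A (U i)" "i < N \<Longrightarrow> anti A (U i) C"
    "i < N \<Longrightarrow> y \<in> C \<Longrightarrow> A y (x i y)" "i < N \<Longrightarrow> y \<in> C \<Longrightarrow> x i y \<in> D"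
    "i < N \<Longrightarrow> j < N \<Longrightarrow> y \<in> C \<Longrightarrow> touches A (x i y) (U j) \<longleftrightarrow> i = j"
    "i < N \<Longrightarrow> j < N \<Longrightarrow> i \<noteq> j \<Longrightarrow> anti A (U i) (U j)"
  using assms by (auto simp: cover_system_def)

text \<open>The inner system, its parents included, lies in \<open>D'\<close> and hence in the level
  \<open>C\<close>, which is anticomplete to the new set; so inner parents miss it automatically.
  That outer parents miss the inner sets has to be assumed in \<open>miss\<close>. The grandparents
  belong to the new set because a parent sees them but not \<open>V\<close>.\<close>

lemma cover_system_extend:
  assumes loc: "locally_col A \<tau> \<rho>" and bfs: "bfs_cover A D V s x C" and D': "D' \<subseteq> C"
    and sys: "cover_system A N D' U xs C'" and C'': "C'' \<subseteq> C'"
    and miss: "\<And>i y. i < N \<Longrightarrow> y \<in> C'' \<Longrightarrow> \<not> touches A (x y) (U i)"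
  shows "cover_system A (Suc N) D (U(N := V \<union> s ` C)) (xs(N := x)) C''"
proof -
  have sym: "symp A" using loc unfolding locally_col_def by blast
  let ?U = "V \<union> s ` C"
  have V: "conn A V" "C \<subseteq> D" "V \<subseteq> D" "anti A V C" "anti A (s ` C) C"
    and b: "\<And>y. y \<in> C \<Longrightarrow> A y (x y) \<and> A (x y) (s y) \<and> touches A (s y) V \<and> x y \<in> D \<and> s y \<in> D"
    using bfs unfolding bfs_cover_def by auto
  note S = cover_systemD[OF sys]
  have U_conn: "conn A ?U" by (rule conn_attach[OF sym V(1)]) (use b in auto)
  have U_D: "?U \<subseteq> D" using V(3) b by auto
  have U_anti: "anti A ?U C" using V(4,5) by (rule anti_UnI)
  have C: "y \<in> C'" "y \<in> D'" "y \<in> C" "y \<in> D" if "y \<in> C''" for y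
    using that C'' S(1) D' V(2) by blast+
  have "C'' \<subseteq> C" using C by blast
  then have U_anti'': "anti A ?U C''" using anti_mono[OF U_anti order_refl] by blast
  have anti1: "anti A ?U (U i)" if "i < N" for i
    using anti_mono[OF U_anti order_refl] S(2)[OF that] D' by blast
  then have anti2: "anti A (U i) ?U" if "i < N" for i
    using that anti_sym[OF sym] by blast
  have anti3: "anti A (U i) C''" if "i < N" for i
    using anti_mono[OF S(4)[OF that] order_refl C''] .
  have t: "touches A (x y) ?U" if "y \<in> C''" for y
    using b[OF C(3)[OF that]] C(3)[OF that] unfolding touches_def by blast
  have t': "\<not> touches A (xs i y) ?U" if "i < N" "y \<in> C''" for i y
    using touches_anti[OF sym U_anti] S(6)[OF that(1) C(1)[OF that(2)]] D' by blast
  have Ui_D: "U i \<subseteq> D" if "i < N" for i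
    using S(2)[OF that] D' V(2) by (meson order_trans)
  have xs_D: "xs i y \<in> D" if "i < N" "y \<in> C''" for i y
    using S(6)[OF that(1) C(1)[OF that(2)]] D' V(2) by (meson subsetD)
  show ?thesis
    unfolding cover_system_def
  proof (intro conjI allI impI ballI)
    show "C'' \<subseteq> D" using C by blast
  next
    fix i assume "i < Suc N"
    then show "(U(N := ?U)) i \<subseteq> D" "conn A ((U(N := ?U)) i)" "anti A ((U(N := ?U)) i) C''"
      using U_D U_conn U_anti'' Ui_D S(3) anti3 by (auto simp: less_Suc_eq)
    fix y assume "y \<in> C''"
    then show "A y ((xs(N := x)) i y)" "(xs(N := x)) i y \<in> D"
      using \<open>i < Suc N\<close> b S(5) C xs_D by (auto simp: less_Suc_eq)
  next
    fix i j y assume "i < Suc N" "j < Suc N" "y \<in> C''"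
    then show "touches A ((xs(N := x)) i y) ((U(N := ?U)) j) \<longleftrightarrow> i = j"
      using t t' miss S(7) C(1) by (auto simp: less_Suc_eq)
  next
    fix i j assume "i < Suc N" "j < Suc N" "i \<noteq> j"
    then show "anti A ((U(N := ?U)) i) ((U(N := ?U)) j)"
      using anti1 anti2 S(8) by (auto simp: less_Suc_eq)
  qed
qed

text \<open>Search once and obtain a level with parents \<open>x\<close>. Without a fat cycle it is
  not rich, so some large \<open>D'\<close> in it is poor: a connected set in \<open>D'\<close>
  serves, through \<open>x\<close>, only a \<open>c\<close>-colourable set anticomplete to it. The
  inner system is built in \<open>D'\<close>, and the few vertices whose outer parent sees an inner
  set are deleted.\<close>

lemma exists_cover_system:
  assumes \<rho>: "4 \<le> \<rho>"
  shows "\<exists>K. \<forall>A (D :: 'a set). locally_col A \<tau> \<rho> \<longrightarrow> \<not> has_fat_cycle A m M (\<rho> - 2) \<longrightarrow> finite D \<longrightarrow>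
    \<not> col A D K \<longrightarrow> (\<exists>U x C. cover_system A N D U x C \<and> \<not> col A C e)"
proof (induction N arbitrary: e)
  case 0
  have "cover_system A 0 D U x D" for A and D :: "'a set" and U x
    unfolding cover_system_def by simp
  then show ?case by blast
next
  case (Suc N)
  obtain KN where KN: "\<And>e A (D :: 'a set). locally_col A \<tau> \<rho> \<Longrightarrow> \<not> has_fat_cycle A m M (\<rho> - 2) \<Longrightarrow>
      finite D \<Longrightarrow> \<not> col A D (KN e) \<Longrightarrow> \<exists>U x C. cover_system A N D U x C \<and> \<not> col A C e"
    using Suc.IH by metis
  \<comment> \<open>\<open>N * c\<close> pays for the vertices deleted on account of the
    \<open>N\<close> inner sets. The number \<open>c\<close> is known only once richness has failed,
    so the bound must be given as a function of it.\<close>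
  define \<phi> where "\<phi> c = KN (e + N * c)" for c
  obtain K where K: "\<And>A D V s (x :: 'a \<Rightarrow> 'a) C. locally_col A \<tau> \<rho> \<Longrightarrow> finite C \<Longrightarrow> rich A \<phi> x C \<Longrightarrow>
    bfs_cover A D V s x C \<Longrightarrow> \<not> col A C K \<Longrightarrow> has_fat_cycle A m M (\<rho> - 2)"
    using rich_has_fat_cycle[OF \<rho>, of \<tau> \<phi> m M] by metis
  \<comment> \<open>\<open>\<tau>\<close> keeps the level away from the root; \<open>K\<close> rules
    out that it is rich.\<close>
  let ?c = "max \<tau> K"
  show ?case
  proof (intro exI[of _ "?c + ?c"] allI impI)
    fix A and D :: "'a set"
    assume loc: "locally_col A \<tau> \<rho>" and no: "\<not> has_fat_cycle A m M (\<rho> - 2)" and fin: "finite D"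
      and big: "\<not> col A D (?c + ?c)"
    obtain V s x C where bfs: "bfs_cover A D V s x C" "\<not> col A C ?c"
      by (rule exists_bfs_cover[OF loc _ _ big]) (use \<rho> in auto)
    have "C \<subseteq> D" using bfs(1) unfolding bfs_cover_def by blast
    then have "finite C" using fin by (rule finite_subset)
    moreover have "\<not> col A C K" using bfs(2) col_mono[of A C K C ?c] by auto
    ultimately have "\<not> rich A \<phi> x C" using K[OF loc _ _ bfs(1)] no by blast
    then obtain c D' where D': "D' \<subseteq> C" "\<not> col A D' (\<phi> c)"
      and poor: "\<And>U C'. U \<subseteq> D' \<Longrightarrow> C' \<subseteq> D' \<Longrightarrow> conn A U \<Longrightarrow> anti A U C' \<Longrightarrow>
        (\<forall>y\<in>C'. touches A (x y) U) \<Longrightarrow> col A C' c"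
      unfolding rich_def by meson
    have "finite D'" using D'(1) \<open>finite C\<close> by (rule finite_subset)
    then obtain U xs C' where sys: "cover_system A N D' U xs C'" "\<not> col A C' (e + N * c)"
      using KN[OF loc no] D'(2) unfolding \<phi>_def by metis
    define bad where "bad i = {y \<in> C'. touches A (x y) (U i)}" for i
    note S = cover_systemD[OF sys(1)]
    have "col A (bad i) c" if i: "i < N" for i
    proof (rule poor[OF S(2)[OF i] _ S(3)[OF i]])
      show "bad i \<subseteq> D'" using S(1) unfolding bad_def by blast
      show "anti A (U i) (bad i)" by (rule anti_mono[OF S(4)[OF i] order_refl]) (auto simp: bad_def)
      show "\<forall>y\<in>bad i. touches A (x y) (U i)" unfolding bad_def by blast
    qed
    then have "col A (\<Union>i<N. bad i) (N * c)" by (rule col_UN)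
    then have "\<not> col A (C' - (\<Union>i<N. bad i)) e" using sys(2) not_col_diff by blast
    moreover have "cover_system A (Suc N) D (U(N := V \<union> s ` C)) (xs(N := x)) (C' - (\<Union>i<N. bad i))"
      by (rule cover_system_extend[OF loc bfs(1) D'(1) sys(1)]) (auto simp: bad_def)
    ultimately show "\<exists>U x C. cover_system A (Suc N) D U x C \<and> \<not> col A C e" by blast
  qed
qed

text \<open>Greedy choice: each point costs its ball, hence \<open>\<tau>\<close> colours.\<close>

lemma exists_far_points:
  assumes loc: "locally_col A \<tau> \<rho>" and "\<not> col A C (n * \<tau>)"
  shows "\<exists>y. (\<forall>a<n. y a \<in> C) \<and> (\<forall>a<n. \<forall>b<n. a \<noteq> b \<longrightarrow> \<not> near A \<rho> (y a) (y b))"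
  using assms(2)
proof (induction n)
  case (Suc n)
  have sym: "symp A" using loc unfolding locally_col_def by blast
  have "\<not> col A C (n * \<tau>)" using Suc.prems col_mono[of A C "n * \<tau>" C] by auto
  then obtain y where y: "\<forall>a<n. y a \<in> C" "\<forall>a<n. \<forall>b<n. a \<noteq> b \<longrightarrow> \<not> near A \<rho> (y a) (y b)"
    using Suc.IH by blast
  have "col A (\<Union>a<n. {u. near A \<rho> (y a) u}) (n * \<tau>)"
    using locally_colD(3)[OF loc] by (intro col_UN) blast
  then have "\<not> col A (C - (\<Union>a<n. {u. near A \<rho> (y a) u})) \<tau>"
    using Suc.prems not_col_diff[of A C \<tau> "n * \<tau>"] by simp
  then obtain z where "z \<in> C - (\<Union>a<n. {u. near A \<rho> (y a) u})" by (rule not_col_obtains)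
  then have z: "z \<in> C" "\<forall>a<n. \<not> near A \<rho> (y a) z" "\<forall>a<n. \<not> near A \<rho> z (y a)"
    using near_sym[OF sym] by auto
  show ?case using y z by (intro exI[of _ "y(n := z)"]) (auto simp: less_Suc_eq)
qed simp

text \<open>For fixed \<open>a\<close> all \<open>x i a\<close> are neighbours of \<open>y a\<close>
  and lie in a \<open>\<tau>\<close>-colourable ball. Keeping the indices of the most frequent
  colour makes them pairwise nonadjacent and divides the number of indices by at most
  \<open>\<tau>\<close>; this is done for each \<open>a\<close> in turn.\<close>

lemma exists_independent_indices:
  assumes loc: "locally_col A \<tau> \<rho>" and "1 \<le> \<rho>"
    and x: "\<And>i a. i < N \<Longrightarrow> a < n \<Longrightarrow> A (y a) (x i a)" and "\<tau> ^ n * q \<le> N"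
  shows "\<exists>I \<subseteq> {..<N}. q \<le> card I \<and>
    (\<forall>a<n. \<forall>i\<in>I. \<forall>j\<in>I. \<not> A (x i a) (x j a))"
  using assms(3,4)
proof (induction n arbitrary: q)
  case 0
  then show ?case by (intro exI[of _ "{..<N}"]) auto
next
  case (Suc n)
  have "\<tau> ^ n * (\<tau> * q) \<le> N" using Suc.prems(2) by (simp add: ac_simps)
  then obtain I where I: "I \<subseteq> {..<N}" "\<tau> * q \<le> card I"
      "\<forall>a<n. \<forall>i\<in>I. \<forall>j\<in>I. \<not> A (x i a) (x j a)"
    using Suc.IH[of "\<tau> * q"] Suc.prems(1) by auto
  obtain c where c: "\<And>u. near A \<rho> (y n) u \<Longrightarrow> c u < \<tau>"
    "\<And>u v. near A \<rho> (y n) u \<Longrightarrow> near A \<rho> (y n) v \<Longrightarrow> A u v \<Longrightarrow> c u \<noteq> (c v :: nat)"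
    using locally_colD(3)[OF loc, of "y n"] unfolding col_def by blast
  have near: "near A \<rho> (y n) (x i n)" if "i \<in> I" for i
  proof -
    have "A (y n) (x i n)" using Suc.prems(1) I(1) that by auto
    then show ?thesis using near_mono[OF near_adj] assms(2) by fastforce
  qed
  let ?J = "\<lambda>k. {i \<in> I. c (x i n) = k}"
  have fin: "finite I" using I(1) by (rule finite_subset) simp
  have "\<exists>k<\<tau>. q \<le> card (?J k)"
  proof (rule ccontr)
    assume *: "\<not> ?thesis"
    have "\<tau> > 0" using c(1)[OF near_refl] by simp
    then have "q > 0" using * by auto
    have "I = (\<Union>k<\<tau>. ?J k)" using near c(1) by auto
    then have "card I \<le> (\<Sum>k<\<tau>. card (?J k))" using card_UN_le[of "{..<\<tau>}" ?J] by simp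
    also have "\<dots> \<le> (\<Sum>k<\<tau>. q - 1)" using * by (intro sum_mono) fastforce
    also have "\<dots> < \<tau> * q" using \<open>\<tau> > 0\<close> \<open>q > 0\<close> by simp
    finally show False using I(2) by simp
  qed
  then obtain k where k: "k < \<tau>" "q \<le> card (?J k)" by blast
  have "\<not> A (x i a) (x j a)" if "i \<in> ?J k" "j \<in> ?J k" "a < Suc n" for i j a
  proof (cases "a = n")
    case True
    then show ?thesis using c(2)[OF near near, of i j] that by auto
  next
    case False
    then show ?thesis using I(3) that by auto
  qed
  then show ?case using k I(1) by (intro exI[of _ "?J k"]) auto
qed

text \<open>Each edge receives its own index \<open>h e\<close>, and its link consists of
  \<open>U (h e)\<close> and the parents with this index of its two ends. Parents of the same
  \<open>y\<close> are separated by independence of the indices, parents of different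
  \<open>y\<close> by distance. There are \<open>Suc (m * M)\<close> edges to serve and
  \<open>Suc m\<close> branch vertices, each costing a factor \<open>\<tau>\<close> in the number of
  indices.\<close>

lemma cover_system_has_fat_cycle:
  assumes loc: "locally_col A \<tau> \<rho>" and \<rho>: "4 \<le> \<rho>" and sys: "cover_system A N D U x C"
    and N: "\<tau> ^ Suc m * Suc (m * M) \<le> N" and C: "\<not> col A C (Suc m * \<tau>)"
  shows "has_fat_cycle A m M (\<rho> - 2)"
proof -
  have sym: "symp A" using loc unfolding locally_col_def by blast
  note S = cover_systemD[OF sys]
  obtain y where y: "\<And>a. a < Suc m \<Longrightarrow> y a \<in> C"
    "\<And>a b. a < Suc m \<Longrightarrow> b < Suc m \<Longrightarrow> a \<noteq> b \<Longrightarrow> \<not> near A \<rho> (y a) (y b)"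
    using exists_far_points[OF loc C] by blast
  obtain I where I: "I \<subseteq> {..<N}" "Suc (m * M) \<le> card I"
    "\<And>a i j. a < Suc m \<Longrightarrow> i \<in> I \<Longrightarrow> j \<in> I \<Longrightarrow> \<not> A (x i (y a)) (x j (y a))"
    using exists_independent_indices[OF loc _ _ N, of y "\<lambda>i a. x i (y a)"] S(5) y(1) \<rho> by auto
  have "card (fat_cycle_edges m M) \<le> card I"
    using I(2) unfolding fat_cycle_edges_def by (simp add: card_insert_if)
  moreover have "finite (fat_cycle_edges m M)" unfolding fat_cycle_edges_def by simp
  moreover have "finite I" using I(1) by (rule finite_subset) simp
  ultimately obtain h where h: "h ` fat_cycle_edges m M \<subseteq> I" "inj_on h (fat_cycle_edges m M)"
    using card_le_inj by metis
  define W where "W e = U (h e) \<union> (\<lambda>a. x (h e) (y a)) ` fat_cycle_ends m e" for e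
  have ends: "a < Suc m" if "e \<in> fat_cycle_edges m M" "a \<in> fat_cycle_ends m e" for e a
    using that unfolding fat_cycle_edges_def fat_cycle_ends_def by (auto split: if_splits)
  have hN: "h e \<in> I" "h e < N" if "e \<in> fat_cycle_edges m M" for e
    using h(1) I(1) that by auto
  have adj: "A (y a) (x i (y a))" if "i < N" "a < Suc m" for i a
    using S(5) y(1) that by blast
  have far: "\<not> near A r (y a) (y b)" if "a < Suc m" "b < Suc m" "a \<noteq> b" "r \<le> 4" for a b r
    using y(2)[OF that(1-3)] near_mono[of A r "y a" "y b" \<rho>] that(4) \<rho> by auto
  have far_x: "\<not> near A r (x i (y a)) (x j (y b))"
    if "i < N" "j < N" "a < Suc m" "b < Suc m" "a \<noteq> b" "r \<le> 2" for a b r i j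
  proof
    assume "near A r (x i (y a)) (x j (y b))"
    then have "near A (Suc (Suc r)) (y a) (y b)"
      using near_two_step[OF sym adj adj] that by blast
    then show False using far[OF that(3-5), of "Suc (Suc r)"] that(6) by auto
  qed
  have y_x: "y b \<noteq> x i (y a)" "A (y b) (x i (y a)) \<longleftrightarrow> b = a"
    if "i < N" "a < Suc m" "b < Suc m" for a b i
  proof -
    have 1: "near A (Suc 0) (y a) (x i (y a))" using adj that by (intro near_adj)
    show "y b \<noteq> x i (y a)"
    proof
      assume eq: "y b = x i (y a)"
      show False
      proof (cases "a = b")
        case True
        then show False using eq adj[of i a] that locally_colD(2)[OF loc] by metis
      next
        case False
        then show False using 1 eq far[of a b "Suc 0"] that by auto
      qed
    qed
    show "A (y b) (x i (y a)) \<longleftrightarrow> b = a"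
    proof
      assume "A (y b) (x i (y a))"
      then have "near A (Suc (Suc 0)) (y b) (y a)"
        using near_two_step[OF sym _ adj near_refl] that by blast
      then show "b = a" using far[of b a "Suc (Suc 0)"] that by auto
    qed (use adj that in blast)
  qed
  \<comment> \<open>The distances here even exceed \<open>\<rho>\<close>; the weaker bound matches
    the rich case.\<close>
  have "\<not> near A (\<rho> - 2) (y a) (y b)" if "a \<le> m" "b \<le> m" "a \<noteq> b" for a b
    using y(2)[of a b] that near_mono[of A "\<rho> - 2" "y a" "y b" \<rho>] by auto
  moreover have "conn A (W e) \<and> (\<forall>b\<in>{..m}. y b \<notin> W e \<and>
      (touches A (y b) (W e) \<longleftrightarrow> b \<in> fat_cycle_ends m e))" if e: "e \<in> fat_cycle_edges m M" for e
  proof (intro conjI ballI)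
    show "conn A (W e)"
      unfolding W_def
    proof (rule conn_attach[OF sym S(3)[OF hN(2)[OF e]]])
      fix v assume "v \<in> (\<lambda>a. x (h e) (y a)) ` fat_cycle_ends m e"
      then obtain a where a: "a \<in> fat_cycle_ends m e" "v = x (h e) (y a)" by blast
      then show "touches A v (U (h e))"
        using S(7)[OF hN(2)[OF e] hN(2)[OF e] y(1)[OF ends[OF e a(1)]]] by simp
    qed
  next
    fix b assume "b \<in> {..m}"
    then have b: "b < Suc m" by simp
    have U: "anti A (U (h e)) C" using S(4) hN(2)[OF e] by blast
    show "y b \<notin> W e"
      using U y(1)[OF b] y_x(1)[OF hN(2)[OF e]] ends[OF e] b unfolding W_def anti_def by blast
    show "touches A (y b) (W e) \<longleftrightarrow> b \<in> fat_cycle_ends m e"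
      using touches_anti[OF sym U y(1)[OF b]] y_x(2)[OF hN(2)[OF e]] ends[OF e] b
      unfolding W_def touches_Un by (auto simp: touches_def)
  qed
  moreover have "anti A (W e) (W f)"
    if e: "e \<in> fat_cycle_edges m M" and f: "f \<in> fat_cycle_edges m M" and ef: "e \<noteq> f" for e f
  proof -
    have he: "h e < N" "h e \<in> I" and hf: "h f < N" "h f \<in> I" using hN e f by auto
    have hh: "h e \<noteq> h f" using h(2) e f ef by (auto dest: inj_onD)
    have x_U: "x i (y a) \<notin> U j" "\<not> touches A (x i (y a)) (U j)"
      if "i < N" "j < N" "i \<noteq> j" "a < Suc m" for i j a
    proof -
      have "touches A (x i (y a)) (U i)" using S(7)[OF that(1,1) y(1)[OF that(4)]] by simp
      then show "x i (y a) \<notin> U j" using touches_anti[OF sym S(8)[OF that(1-3)]] by blast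
      show "\<not> touches A (x i (y a)) (U j)" using S(7)[OF that(1,2) y(1)[OF that(4)]] that(3) by simp
    qed
    have x_x: "x (h e) (y a) \<noteq> x (h f) (y b)" "\<not> A (x (h e) (y a)) (x (h f) (y b))"
      if "a < Suc m" "b < Suc m" for a b
    proof -
      show "x (h e) (y a) \<noteq> x (h f) (y b)"
      proof (cases "a = b")
        case True
        have "touches A (x (h e) (y a)) (U (h e))"
          using S(7)[OF he(1,1) y(1)[OF that(1)]] by simp
        then show ?thesis using x_U(2)[OF hf(1) he(1) hh[symmetric] that(2)] by metis
      next
        case False
        then have "\<not> near A 0 (x (h e) (y a)) (x (h f) (y b))"
          using far_x[OF he(1) hf(1) that] by simp
        then show ?thesis using near_refl by metis
      qed
      show "\<not> A (x (h e) (y a)) (x (h f) (y b))"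
      proof (cases "a = b")
        case True
        then show ?thesis using I(3) he hf that by blast
      next
        case False
        then have "\<not> near A (Suc 0) (x (h e) (y a)) (x (h f) (y b))"
          using far_x[OF he(1) hf(1) that] by simp
        then show ?thesis using near_adj by metis
      qed
    qed
    have 1: "anti A (U (h e)) (U (h f))" using S(8) he hf hh by blast
    have 2: "x (h e) (y a) \<notin> U (h f)" "\<not> A (x (h e) (y a)) u"
      if "a < Suc m" "u \<in> U (h f)" for a u
      using x_U[OF he(1) hf(1) hh that(1)] that(2) unfolding touches_def by blast+
    have 3: "x (h f) (y a) \<notin> U (h e)" "\<not> A u (x (h f) (y a))"
      if "a < Suc m" "u \<in> U (h e)" for a u
      using x_U[OF hf(1) he(1) hh[symmetric] that(1)] that(2) locally_colD(1)[OF loc]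
      unfolding touches_def by blast+
    show ?thesis
      unfolding anti_def
    proof (intro conjI ballI)
      show "W e \<inter> W f = {}"
        using 1 2(1) 3(1) x_x(1) ends[OF e] ends[OF f] unfolding W_def anti_def by blast
    next
      fix u v assume "u \<in> W e" "v \<in> W f"
      then show "\<not> A u v"
        using 1 2(2) 3(2) x_x(2) ends[OF e] ends[OF f] unfolding W_def anti_def by blast
    qed
  qed
  ultimately have "link_model A {..m} (fat_cycle_edges m M) (fat_cycle_ends m) (\<rho> - 2) y W"
    unfolding link_model_def by simp
  then show ?thesis unfolding has_fat_cycle_def by blast
qed

theorem exists_fat_cycle:
  assumes \<rho>: "4 \<le> \<rho>"
  shows "\<exists>K. \<forall>A (D :: 'a set). locally_col A \<tau> \<rho> \<longrightarrow> finite D \<longrightarrow> \<not> col A D K \<longrightarrow>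
    has_fat_cycle A m M (\<rho> - 2)"
proof -
  let ?N = "\<tau> ^ Suc m * Suc (m * M)" and ?e = "Suc m * \<tau>"
  obtain K where K: "\<And>A (D :: 'a set). locally_col A \<tau> \<rho> \<Longrightarrow> \<not> has_fat_cycle A m M (\<rho> - 2) \<Longrightarrow>
      finite D \<Longrightarrow> \<not> col A D K \<Longrightarrow> \<exists>U x C. cover_system A ?N D U x C \<and> \<not> col A C ?e"
    using exists_cover_system[OF \<rho>, of \<tau> m M ?N ?e] by metis
  then show ?thesis using cover_system_has_fat_cycle[OF _ \<rho> _ order_refl] by metis
qed

section \<open>From models to induced subdivisions\<close>

text \<open>The \<open>i\<close>-th vertex of a shortest walk has level exactly \<open>i\<close>. So
  its vertices are distinct, and since levels of adjacent vertices differ by at most one, the path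
  has no chords.\<close>

lemma shortest_path:
  assumes sym: "symp A" and irr: "irreflp A" and S: "(a, b) \<in> (adj_in A S)\<^sup>*" "a \<in> S"
  obtains p where "p \<noteq> []" "hd p = a" "last p = b" "distinct p" "set p \<subseteq> S"
    "length p = Suc (lev A S a b)"
    "\<And>i. Suc i < length p \<Longrightarrow> A (p ! i) (p ! Suc i)"
    "\<And>u v. u \<in> set p \<Longrightarrow> v \<in> set p \<Longrightarrow> A u v \<Longrightarrow> {u, v} \<in> path_edges p"
proof -
  let ?l = "lev A S a"
  obtain f where f: "f 0 = a" "f (?l b) = b" "\<And>i. i < ?l b \<Longrightarrow> (f i, f (Suc i)) \<in> adj_in A S"
    using lev_relpow[OF S(1)] unfolding relpow_fun_conv by blast
  have fS: "f i \<in> S" if "i \<le> ?l b" for i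
    using f(1) f(3)[of "i - 1"] S(2) that by (cases i) (auto simp: adj_in_def)
  have reach: "(a, f i) \<in> adj_in A S ^^ i" if "i \<le> ?l b" for i
    using that f(1,3) by (auto simp: relpow_fun_conv intro!: exI[of _ f])
  have le: "?l (f i) \<le> i" if "i \<le> ?l b" for i
    using reach[OF that] by (rule lev_le)
  have r: "(a, f i) \<in> (adj_in A S)\<^sup>*" if "i \<le> ?l b" for i
    using reach[OF that] by (rule relpow_imp_rtrancl)
  have "?l b \<le> ?l (f i) + (?l b - i)" if "i \<le> ?l b" for i
  proof -
    have "(f i, b) \<in> adj_in A S ^^ (?l b - i)"
      using that f(2,3) by (auto simp: relpow_fun_conv intro!: exI[of _ "\<lambda>k. f (i + k)"])
    then have "(a, b) \<in> adj_in A S ^^ (?l (f i) + (?l b - i))"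
      using lev_relpow[OF r[OF that]] by (auto simp: relpow_add)
    then show ?thesis by (rule lev_le)
  qed
  then have lv: "?l (f i) = i" if "i \<le> ?l b" for i using le[OF that] that by fastforce
  define p where "p = map f [0..<Suc (?l b)]"
  have len: "length p = Suc (?l b)" and nth: "\<And>i. i \<le> ?l b \<Longrightarrow> p ! i = f i"
    unfolding p_def by (simp_all del: upt_Suc)
  have "inj_on f {0..<Suc (?l b)}" by (rule inj_on_inverseI[of _ ?l]) (use lv in auto)
  then have "distinct p" unfolding p_def by (simp add: distinct_map del: upt_Suc)
  moreover have "set p \<subseteq> S" using fS unfolding p_def by auto
  moreover have "p \<noteq> []" using len by auto
  moreover from this have "hd p = a" "last p = b"
    using len nth f(1,2) by (simp_all add: hd_conv_nth last_conv_nth)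
  moreover have "A (p ! i) (p ! Suc i)" if "Suc i < length p" for i
    using that f(3)[of i] nth len unfolding adj_in_def by auto
  moreover have "{u, v} \<in> path_edges p" if uv: "u \<in> set p" "v \<in> set p" "A u v" for u v
  proof -
    obtain i j where i: "i \<le> ?l b" "u = f i" and j: "j \<le> ?l b" "v = f j"
      using uv(1,2) unfolding p_def by (auto simp del: upt_Suc simp: less_Suc_eq_le)
    have e: "(u, v) \<in> adj_in A S" "(v, u) \<in> adj_in A S"
      using uv(3) i j fS sym unfolding adj_in_def by (auto dest: sympD)
    have "j \<le> Suc i" "i \<le> Suc j"
      using lev_adj[OF _ e(1), of a] lev_adj[OF _ e(2), of a] r[OF i(1)] r[OF j(1)] lv i j by auto
    moreover have "i \<noteq> j" using uv(3) i j irr by (auto dest: irreflpD)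
    ultimately consider "j = Suc i" | "i = Suc j" by linarith
    then show ?thesis
    proof cases
      case 1
      then show ?thesis unfolding path_edges_def using i j nth len
        by (intro CollectI exI[of _ i]) auto
    next
      case 2
      then show ?thesis unfolding path_edges_def using i j nth len
        by (intro CollectI exI[of _ j]) auto
    qed
  qed
  ultimately show thesis using that len by blast
qed

lemma inner_verts_iff: "u \<in> inner_verts p \<longleftrightarrow> (\<exists>i. 0 < i \<and> Suc i < length p \<and> p ! i = u)"
proof
  assume "u \<in> inner_verts p"
  then obtain j where "j < length (butlast (tl p))" "butlast (tl p) ! j = u"
    unfolding inner_verts_def by (auto simp: in_set_conv_nth)
  then show "\<exists>i. 0 < i \<and> Suc i < length p \<and> p ! i = u"
    by (intro exI[of _ "Suc j"]) (auto simp: nth_butlast nth_tl)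
next
  assume "\<exists>i. 0 < i \<and> Suc i < length p \<and> p ! i = u"
  then obtain i where i: "0 < i" "Suc i < length p" "p ! i = u" by blast
  then have "i - 1 < length (butlast (tl p))" "butlast (tl p) ! (i - 1) = u"
    by (auto simp: nth_butlast nth_tl)
  then show "u \<in> inner_verts p" unfolding inner_verts_def by (metis nth_mem)
qed

lemma set_path_conv: "p \<noteq> [] \<Longrightarrow> set p = insert (hd p) (insert (last p) (inner_verts p))"
  unfolding inner_verts_def
  by (cases p rule: list.exhaust; cases "tl p" rule: rev_cases) auto

text \<open>\<open>is_subdivision\<close> with its witnesses exposed, so that two subdivisions of
  the same \<open>H\<close> can be compared path by path.\<close>

definition subdivision_via ::
    "'a graph \<Rightarrow> ('v, 'e) mgraph \<Rightarrow> ('v \<Rightarrow> 'a) \<Rightarrow> ('e \<Rightarrow> 'a list) \<Rightarrow> bool" where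
  "subdivision_via J H \<phi> P \<longleftrightarrow> inj_on \<phi> (mverts H) \<and>
     (\<forall>e\<in>medges H. is_path J (P e) \<and> {hd (P e), last (P e)} = \<phi> ` mends H e \<and>
                   inner_verts (P e) \<inter> \<phi> ` mverts H = {}) \<and>
     (\<forall>e\<in>medges H. \<forall>f\<in>medges H. e \<noteq> f \<longrightarrow>
         inner_verts (P e) \<inter> inner_verts (P f) = {} \<and>
         path_edges (P e) \<inter> path_edges (P f) = {}) \<and>
     verts J = \<phi> ` mverts H \<union> (\<Union>e\<in>medges H. set (P e)) \<and>
     edges J = (\<Union>e\<in>medges H. path_edges (P e))"

lemma is_subdivision_iff: "is_subdivision J H \<longleftrightarrow> simple_graph J \<and> (\<exists>\<phi> P. subdivision_via J H \<phi> P)"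
  unfolding is_subdivision_def subdivision_via_def ..

definition adjacent :: "'a graph \<Rightarrow> 'a \<Rightarrow> 'a \<Rightarrow> bool" where
  "adjacent G u v \<longleftrightarrow> {u, v} \<in> edges G"

lemma symp_adjacent: "symp (adjacent G)"
  by (auto intro: sympI simp: adjacent_def insert_commute)

lemma irreflp_adjacent:
  assumes "simple_graph G"
  shows "irreflp (adjacent G)"
proof (rule irreflpI)
  fix v
  show "\<not> adjacent G v v"
  proof
    assume "adjacent G v v"
    then have "card {v, v} = 2" using assms unfolding adjacent_def simple_graph_def by blast
    then show False by simp
  qed
qed

lemma adjacent_verts: "simple_graph G \<Longrightarrow> adjacent G u v \<Longrightarrow> u \<in> verts G \<and> v \<in> verts G"
  unfolding simple_graph_def adjacent_def by (meson insertI1 insertI2 subsetD)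

lemma path_edges_nth: "Suc i < length p \<Longrightarrow> {p ! i, p ! Suc i} \<in> path_edges p"
  unfolding path_edges_def by blast

lemma path_edges_subset: "d \<in> path_edges p \<Longrightarrow> d \<subseteq> set p"
  unfolding path_edges_def by (auto intro: nth_mem Suc_lessD)

lemma simple_graph_induced: "simple_graph G \<Longrightarrow> simple_graph (induced G S)"
  unfolding simple_graph_def induced_def by auto

text \<open>\<open>R e\<close> is a shortest path through \<open>W e\<close> between the two ends.
  Its length bounds their distance from above, so it exceeds \<open>L\<close>. The functions
  \<open>a\<close> and \<open>b\<close> fix an orientation, to be matched with that of the paths in
  \<open>J\<close>.\<close>

lemma link_model_induced_subdivision:
  assumes G: "simple_graph G" and H: "multigraph H" and L: "2 \<le> L"
    and model: "link_model (adjacent G) (mverts H) (medges H) (mends H) L w W"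
    and w_verts: "w ` mverts H \<subseteq> verts G"
    and ends: "\<And>e. e \<in> medges H \<Longrightarrow> mends H e = {a e, b e}"
  obtains S R where "S \<subseteq> verts G" "subdivision_via (induced G S) H w R"
    "\<And>e. e \<in> medges H \<Longrightarrow> hd (R e) = w (a e) \<and> last (R e) = w (b e) \<and> L < length (R e)"
proof -
  let ?A = "adjacent G"
  note sym = symp_adjacent[of G]
  have irr: "irreflp ?A" using G by (rule irreflp_adjacent)
  have far: "\<not> near ?A L (w u) (w v)" if "u \<in> mverts H" "v \<in> mverts H" "u \<noteq> v" for u v
    using model that unfolding link_model_def by blast
  have W: "conn ?A (W e)" "\<And>v. v \<in> mverts H \<Longrightarrow> w v \<notin> W e"
    "\<And>v. v \<in> mverts H \<Longrightarrow> touches ?A (w v) (W e) \<longleftrightarrow> v \<in> mends H e" if "e \<in> medges H" for e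
    using model that unfolding link_model_def by blast+
  have W_anti: "anti ?A (W e) (W f)" if "e \<in> medges H" "f \<in> medges H" "e \<noteq> f" for e f
    using model that unfolding link_model_def by blast
  have ab: "a e \<in> mverts H" "b e \<in> mverts H" "a e \<noteq> b e" if "e \<in> medges H" for e
    using H ends[OF that] that unfolding multigraph_def by (auto simp: card_insert_if)
  have inj: "inj_on w (mverts H)" using far near_refl by (metis inj_onI)
  let ?W = "\<lambda>e. insert (w (a e)) (insert (w (b e)) (W e))"
  define good where "good e p \<longleftrightarrow> p \<noteq> [] \<and> hd p = w (a e) \<and> last p = w (b e) \<and> distinct p \<and>
    set p \<subseteq> ?W e \<and> near ?A (length p - 1) (w (a e)) (w (b e)) \<and>
    (\<forall>i. Suc i < length p \<longrightarrow> ?A (p ! i) (p ! Suc i)) \<and>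
    (\<forall>u v. u \<in> set p \<longrightarrow> v \<in> set p \<longrightarrow> ?A u v \<longrightarrow> {u, v} \<in> path_edges p)" for e p
  have "\<exists>p. good e p" if e: "e \<in> medges H" for e
  proof -
    have t: "touches ?A (w (a e)) (W e)" "touches ?A (w (b e)) (W e)"
      using W(3)[OF e] ab[OF e] ends[OF e] by auto
    have "conn ?A (insert (w (b e)) (W e))" using conn_insert[OF sym W(1)[OF e] t(2)] .
    then have "conn ?A (?W e)"
      by (rule conn_insert[OF sym]) (rule touches_mono[OF t(1)], blast)
    then have ab_W: "(w (a e), w (b e)) \<in> (adj_in ?A (?W e))\<^sup>*" unfolding conn_def by blast
    have "near ?A (lev ?A (?W e) (w (a e)) (w (b e))) (w (a e)) (w (b e))"
      unfolding near_def using relpow_adj_in_mono[OF subset_UNIV lev_relpow[OF ab_W]] by blast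
    moreover obtain p where "p \<noteq> []" "hd p = w (a e)" "last p = w (b e)" "distinct p"
      "set p \<subseteq> ?W e" "length p = Suc (lev ?A (?W e) (w (a e)) (w (b e)))"
      "\<And>i. Suc i < length p \<Longrightarrow> ?A (p ! i) (p ! Suc i)"
      "\<And>u v. u \<in> set p \<Longrightarrow> v \<in> set p \<Longrightarrow> ?A u v \<Longrightarrow> {u, v} \<in> path_edges p"
      using shortest_path[OF sym irr ab_W insertI1] by metis
    ultimately have "good e p" unfolding good_def by simp
    then show ?thesis by blast
  qed
  then obtain R where "\<And>e. e \<in> medges H \<Longrightarrow> good e (R e)" by metis
  note R = this[unfolded good_def]
  have R_len: "L < length (R e)" if "e \<in> medges H" for e
    using R[OF that] far[of "a e" "b e"] ab[OF that] near_mono[of ?A "length (R e) - 1" _ _ L]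
    by fastforce
  have inner: "inner_verts (R e) \<subseteq> W e" if e: "e \<in> medges H" for e
  proof
    fix u assume "u \<in> inner_verts (R e)"
    then obtain i where i: "0 < i" "Suc i < length (R e)" "R e ! i = u"
      unfolding inner_verts_iff by blast
    have "R e ! 0 = w (a e)" "R e ! (length (R e) - 1) = w (b e)"
      using R[OF e] by (metis hd_conv_nth, metis last_conv_nth)
    moreover have "distinct (R e)" "R e \<noteq> []" using R[OF e] by blast+
    then have "R e ! i \<noteq> R e ! 0" "R e ! i \<noteq> R e ! (length (R e) - 1)"
      using i(1,2) by (auto simp: nth_eq_iff_index_eq less_diff_conv)
    ultimately have "u \<noteq> w (a e)" "u \<noteq> w (b e)" using i(3) by auto
    moreover have "u \<in> ?W e" using R[OF e] i nth_mem[of i "R e"] by auto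
    ultimately show "u \<in> W e" by blast
  qed
  define S where "S = w ` mverts H \<union> (\<Union>e\<in>medges H. set (R e))"
  have R_set: "set (R e) = {w (a e), w (b e)} \<union> inner_verts (R e)" if "e \<in> medges H" for e
    using R[OF that] set_path_conv[of "R e"] by auto
  have R_verts: "set (R e) \<subseteq> verts G" if e: "e \<in> medges H" for e
  proof
    fix u assume "u \<in> set (R e)"
    then consider "u \<in> w ` mverts H" | "u \<in> inner_verts (R e)" using R_set[OF e] ab[OF e] by blast
    then show "u \<in> verts G"
    proof cases
      case 2
      then obtain i where i: "0 < i" "Suc i < length (R e)" "R e ! i = u"
        unfolding inner_verts_iff by blast
      then show ?thesis using R[OF e] adjacent_verts[OF G] by blast
    qed (use w_verts in blast)
  qed
  have S_verts: "S \<subseteq> verts G" unfolding S_def using w_verts R_verts by blast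
  have disj: "inner_verts (R e) \<inter> w ` mverts H = {}" if "e \<in> medges H" for e
    using inner[OF that] W(2)[OF that] by blast
  have w_R: "u \<in> {a e, b e}" if "e \<in> medges H" "u \<in> mverts H" "w u \<in> set (R e)" for e u
    using that R_set[OF that(1)] disj[OF that(1)] ab[OF that(1)] inj by (auto dest: inj_onD)
  have R_edges: "{u, v} \<in> path_edges (R e)"
    if "e \<in> medges H" "u \<in> set (R e)" "v \<in> set (R e)" "?A u v" for e u v
    using R that by blast
  \<comment> \<open>An edge of the induced graph has both ends on a common path: branch vertices are
    too far apart to be adjacent, a branch vertex sees only links of edges at it, and different
    links are anticomplete. On one path there are no chords.\<close>
  have one: "\<exists>e\<in>medges H. u \<in> set (R e) \<and> v \<in> set (R e)" if uv: "u \<in> S" "v \<in> S" "?A u v" for u v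
  proof -
    have wW: "x \<in> mends H e" if "x \<in> mverts H" "e \<in> medges H" "z \<in> inner_verts (R e)" "?A (w x) z"
      for x e z
      using W(3)[OF that(2,1)] inner[OF that(2)] that(3,4) unfolding touches_def by blast
    have wR: "\<exists>e\<in>medges H. w x \<in> set (R e) \<and> z \<in> set (R e)"
      if "x \<in> mverts H" "e \<in> medges H" "z \<in> inner_verts (R e)" "?A (w x) z" for x e z
    proof (rule bexI[OF conjI that(2)])
      show "w x \<in> set (R e)" using wW[OF that] ends[OF that(2)] R_set[OF that(2)] by auto
      show "z \<in> set (R e)" using that(3) R_set[OF that(2)] by auto
    qed
    have split: "(\<exists>x\<in>mverts H. z = w x) \<or> (\<exists>e\<in>medges H. z \<in> inner_verts (R e))" if z: "z \<in> S" for z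
    proof -
      consider "z \<in> w ` mverts H" | e where "e \<in> medges H" "z \<in> set (R e)"
        using z unfolding S_def by auto
      then show ?thesis
      proof cases
        case 2
        then show ?thesis using R_set[OF 2(1)] ab[OF 2(1)] by auto
      qed blast
    qed
    consider x y where "x \<in> mverts H" "y \<in> mverts H" "u = w x" "v = w y"
      | x e where "x \<in> mverts H" "u = w x" "e \<in> medges H" "v \<in> inner_verts (R e)"
      | x e where "x \<in> mverts H" "v = w x" "e \<in> medges H" "u \<in> inner_verts (R e)"
      | e f where "e \<in> medges H" "f \<in> medges H" "u \<in> inner_verts (R e)" "v \<in> inner_verts (R f)"
      using split[OF uv(1)] split[OF uv(2)] by blast
    then show ?thesis
    proof cases
      case 1
      have "near ?A L u v" using near_mono[OF near_adj[of ?A u v, OF uv(3)]] L by simp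
      moreover have "u \<noteq> v" using uv(3) irr by (auto dest: irreflpD)
      ultimately show ?thesis using far[of x y] 1 by auto
    next
      case 2
      then show ?thesis using wR[OF 2(1,3,4)] uv(3) by auto
    next
      case 3
      have "?A v u" using uv(3) sym by (meson sympD)
      then show ?thesis using wR[OF 3(1,3,4)] 3(2) by auto
    next
      case 4
      have "u \<in> W e" "v \<in> W f" using 4 inner by auto
      then have "e = f" using W_anti[OF 4(1,2)] uv(3) unfolding anti_def by auto
      then show ?thesis using 4 R_set by auto
    qed
  qed
  have edges_S: "edges (induced G S) = (\<Union>e\<in>medges H. path_edges (R e))"
  proof (intro set_eqI iffI)
    fix d assume "d \<in> edges (induced G S)"
    then have d: "d \<in> edges G" "d \<subseteq> S" unfolding induced_def by auto
    then obtain u v where uv: "d = {u, v}"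
      using G unfolding simple_graph_def by (metis card_2_iff)
    then have "?A u v" "u \<in> S" "v \<in> S" using d unfolding adjacent_def by auto
    then show "d \<in> (\<Union>e\<in>medges H. path_edges (R e))" using one[of u v] R_edges[of _ u v] uv by auto
  next
    fix d assume "d \<in> (\<Union>e\<in>medges H. path_edges (R e))"
    then obtain e i where e: "e \<in> medges H" "Suc i < length (R e)" "d = {R e ! i, R e ! Suc i}"
      unfolding path_edges_def by blast
    then have "?A (R e ! i) (R e ! Suc i)" using R by blast
    moreover have "R e ! i \<in> set (R e)" "R e ! Suc i \<in> set (R e)" using e(2) by auto
    then have "R e ! i \<in> S" "R e ! Suc i \<in> S" unfolding S_def using e(1) by blast+
    ultimately show "d \<in> edges (induced G S)" unfolding induced_def adjacent_def using e(3) by simp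
  qed
  have verts_S: "verts (induced G S) = S" unfolding induced_def using S_verts by auto
  have "is_path (induced G S) (R e)" if e: "e \<in> medges H" for e
  proof -
    have "R e \<noteq> []" "distinct (R e)" using R[OF e] by auto
    moreover have "set (R e) \<subseteq> S" unfolding S_def using e by blast
    moreover have "path_edges (R e) \<subseteq> edges (induced G S)" unfolding edges_S using e by blast
    ultimately show ?thesis unfolding is_path_def verts_S by simp
  qed
  moreover have "{hd (R e), last (R e)} = w ` mends H e" if e: "e \<in> medges H" for e
    using R[OF e] ends[OF e] by simp
  moreover have in_disj: "inner_verts (R e) \<inter> inner_verts (R f) = {}"
    if ef: "e \<in> medges H" "f \<in> medges H" "e \<noteq> f" for e f
    using inner[OF ef(1)] inner[OF ef(2)] W_anti[OF ef] unfolding anti_def by blast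
  moreover have "path_edges (R e) \<inter> path_edges (R f) = {}"
    if ef: "e \<in> medges H" "f \<in> medges H" "e \<noteq> f" for e f
  proof (rule ccontr)
    assume "\<not> ?thesis"
    then obtain d where d: "d \<in> path_edges (R e)" "d \<in> path_edges (R f)" by blast
    then obtain i where i: "Suc i < length (R e)" "d = {R e ! i, R e ! Suc i}"
      unfolding path_edges_def by blast
    have d_sub: "d \<subseteq> set (R e)" "d \<subseteq> set (R f)" using d path_edges_subset by auto
    \<comment> \<open>Interiors are disjoint and avoid the branch vertices, so a shared edge would
      join two branch vertices; these are not adjacent.\<close>
    have dw: "d \<subseteq> w ` mverts H"
    proof
      fix z assume "z \<in> d"
      then have "z \<in> {w (a e), w (b e)} \<union> inner_verts (R e)"
        "z \<in> {w (a f), w (b f)} \<union> inner_verts (R f)"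
        using d_sub R_set[OF ef(1)] R_set[OF ef(2)] by auto
      then show "z \<in> w ` mverts H" using in_disj[OF ef] ab[OF ef(1)] ab[OF ef(2)] by auto
    qed
    have adj: "?A (R e ! i) (R e ! Suc i)" using R[OF ef(1)] i by blast
    obtain x y where xy: "x \<in> mverts H" "y \<in> mverts H" "R e ! i = w x" "R e ! Suc i = w y"
      using dw i(2) by blast
    have "near ?A L (w x) (w y)" using near_mono[OF near_adj[of ?A "w x" "w y"]] L adj xy by simp
    moreover have "w x \<noteq> w y" using adj xy irr by (auto dest: irreflpD)
    ultimately show False using far xy(1,2) by blast
  qed
  ultimately have "subdivision_via (induced G S) H w R"
    unfolding subdivision_via_def using inj disj edges_S verts_S S_def by (intro conjI ballI impI) auto
  then show thesis using that[of S R] S_verts R R_len by blast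
qed

section \<open>Refining a subdivision\<close>

lemma subdivision_viaD:
  assumes "subdivision_via J H \<phi> P"
  shows "inj_on \<phi> (mverts H)"
    and "e \<in> medges H \<Longrightarrow> is_path J (P e)"
    and "e \<in> medges H \<Longrightarrow> {hd (P e), last (P e)} = \<phi> ` mends H e"
    and "e \<in> medges H \<Longrightarrow> inner_verts (P e) \<inter> \<phi> ` mverts H = {}"
    and "e \<in> medges H \<Longrightarrow> f \<in> medges H \<Longrightarrow> e \<noteq> f \<Longrightarrow> inner_verts (P e) \<inter> inner_verts (P f) = {}"
    and "e \<in> medges H \<Longrightarrow> f \<in> medges H \<Longrightarrow> e \<noteq> f \<Longrightarrow> path_edges (P e) \<inter> path_edges (P f) = {}"
    and "verts J = \<phi> ` mverts H \<union> (\<Union>e\<in>medges H. set (P e))"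
    and "edges J = (\<Union>e\<in>medges H. path_edges (P e))"
  using assms unfolding subdivision_via_def by simp_all

lemma path_edge_index_unique:
  assumes "distinct p" "Suc i < length p" "Suc j < length p" "{p ! i, p ! Suc i} = {p ! j, p ! Suc j}"
  shows "i = j"
  using assms by (auto simp: doubleton_eq_iff nth_eq_iff_index_eq)

text \<open>A path can be obtained by subdividing any path with no more vertices, so
  \<open>K\<close> arises from \<open>J\<close> by stretching each \<open>P e\<close> to
  \<open>R e\<close>. The common orientation lets positions along \<open>P e\<close> and
  \<open>R e\<close> correspond.\<close>

lemma subdivision_refines:
  assumes K: "simple_graph K" and J: "subdivision_via J H \<phi> P" and KH: "subdivision_via K H w R"
    and H: "multigraph H"
    and ends: "\<And>e. e \<in> medges H \<Longrightarrow> mends H e = {a e, b e} \<and> hd (P e) = \<phi> (a e) \<and>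
      last (P e) = \<phi> (b e) \<and> hd (R e) = w (a e) \<and> last (R e) = w (b e)"
    and len: "\<And>e. e \<in> medges H \<Longrightarrow> length (P e) \<le> length (R e)"
  shows "is_subdivision K (mgraph_of J)"
proof -
  note J_inj = subdivision_viaD(1)[OF J] and K_inj = subdivision_viaD(1)[OF KH]
  note JP = subdivision_viaD(2,4)[OF J] and KR = subdivision_viaD(2,4)[OF KH]
  note JD = subdivision_viaD(5,6)[OF J] and KD = subdivision_viaD(5,6)[OF KH]
  note J_verts = subdivision_viaD(7)[OF J] and J_edges = subdivision_viaD(8)[OF J]
  note K_verts = subdivision_viaD(7)[OF KH] and K_edges = subdivision_viaD(8)[OF KH]
  have ab: "a e \<in> mverts H" "b e \<in> mverts H" "a e \<noteq> b e" if "e \<in> medges H" for e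
    using H ends[OF that] that unfolding multigraph_def by (auto simp: card_insert_if)
  have dist: "distinct (P e)" "distinct (R e)" "P e \<noteq> []" "R e \<noteq> []" if "e \<in> medges H" for e
    using JP(1)[OF that] KR(1)[OF that] unfolding is_path_def by auto
  have len2: "2 \<le> length (P e)" if "e \<in> medges H" for e
  proof -
    have "hd (P e) \<noteq> last (P e)" using ends[OF that] ab[OF that] J_inj by (auto dest: inj_onD)
    then show ?thesis using dist(3)[OF that] by (cases "P e"; cases "tl (P e)") auto
  qed

  have P_inner: "e = f \<and> i = j"
    if "e \<in> medges H" "f \<in> medges H" "0 < i" "Suc i < length (P e)" "0 < j" "Suc j < length (P f)"
      "P e ! i = P f ! j" for e f i j
  proof -
    have "P e ! i \<in> inner_verts (P e)" "P e ! i \<in> inner_verts (P f)"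
      unfolding inner_verts_iff using that by metis+
    then have "e = f" using JD(1)[OF that(1,2)] by auto
    then show ?thesis using that dist(1) by (simp add: nth_eq_iff_index_eq)
  qed
  have R_inner: "e = f \<and> i = j"
    if "e \<in> medges H" "f \<in> medges H" "0 < i" "Suc i < length (R e)" "0 < j" "Suc j < length (R f)"
      "R e ! i = R f ! j" for e f i j
  proof -
    have "R e ! i \<in> inner_verts (R e)" "R e ! i \<in> inner_verts (R f)"
      unfolding inner_verts_iff using that by metis+
    then have "e = f" using KD(1)[OF that(1,2)] by auto
    then show ?thesis using that dist(2) by (simp add: nth_eq_iff_index_eq)
  qed
  have P_w: "P e ! i \<notin> \<phi> ` mverts H" if "e \<in> medges H" "0 < i" "Suc i < length (P e)" for e i
    using JP(2)[OF that(1)] that unfolding inner_verts_iff disjoint_iff by metis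
  have R_w: "R e ! i \<notin> w ` mverts H" if "e \<in> medges H" "0 < i" "Suc i < length (R e)" for e i
    using KR(2)[OF that(1)] that unfolding inner_verts_iff disjoint_iff by metis

  \<comment> \<open>Branch vertices go to branch vertices; an interior vertex of \<open>P e\<close>
    goes to the vertex of \<open>R e\<close> at the same position. By \<open>P_inner\<close> the
    pair chosen by \<open>SOME\<close> is unique.\<close>
  define \<psi> where "\<psi> u = (if u \<in> \<phi> ` mverts H then w (inv_into (mverts H) \<phi> u) else
    (let (e, i) = SOME (e, i). e \<in> medges H \<and> 0 < i \<and> Suc i < length (P e) \<and> P e ! i = u
     in R e ! i))" for u
  have \<psi>_w: "\<psi> (\<phi> v) = w v" if "v \<in> mverts H" for v
    using that J_inj unfolding \<psi>_def by simp
  have \<psi>_inner: "\<psi> (P e ! i) = R e ! i" if "e \<in> medges H" "0 < i" "Suc i < length (P e)" for e i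
  proof -
    have "(SOME (f, j). f \<in> medges H \<and> 0 < j \<and> Suc j < length (P f) \<and> P f ! j = P e ! i) = (e, i)"
      by (rule some_equality) (use that P_inner in auto)
    then show ?thesis using P_w[OF that] unfolding \<psi>_def by simp
  qed
  have \<psi>_nth: "\<psi> (P e ! i) = R e ! i" if "e \<in> medges H" "Suc i < length (P e)" for e i
  proof (cases "i = 0")
    case True
    have "P e ! 0 = \<phi> (a e)" "R e ! 0 = w (a e)"
      using ends[OF that(1)] dist(3,4)[OF that(1)] by (auto simp: hd_conv_nth)
    then show ?thesis using True \<psi>_w ab(1)[OF that(1)] by simp
  qed (use \<psi>_inner that in simp)
  have \<psi>_last: "\<psi> (P e ! (length (P e) - 1)) = R e ! (length (R e) - 1)" if "e \<in> medges H" for e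
  proof -
    have "P e ! (length (P e) - 1) = \<phi> (b e)" "R e ! (length (R e) - 1) = w (b e)"
      using ends[OF that] dist(3,4)[OF that] by (auto simp: last_conv_nth)
    then show ?thesis using \<psi>_w ab(2)[OF that] by simp
  qed
  have J_cases: "(\<exists>v\<in>mverts H. u = \<phi> v) \<or>
      (\<exists>e i. e \<in> medges H \<and> 0 < i \<and> Suc i < length (P e) \<and> u = P e ! i)" if u: "u \<in> verts J" for u
  proof -
    consider "u \<in> \<phi> ` mverts H" | e where "e \<in> medges H" "u \<in> set (P e)"
      using u unfolding J_verts by auto
    then show ?thesis
    proof cases
      case 2
      have "u = \<phi> (a e) \<or> u = \<phi> (b e) \<or> u \<in> inner_verts (P e)"
        using 2(2) set_path_conv[OF dist(3)[OF 2(1)]] ends[OF 2(1)] by auto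
      then show ?thesis using ab[OF 2(1)] 2(1) unfolding inner_verts_iff by auto
    qed auto
  qed
  have \<psi>_image: "\<psi> u \<in> w ` mverts H \<or>
      (\<exists>e i. e \<in> medges H \<and> 0 < i \<and> Suc i < length (P e) \<and> \<psi> u = R e ! i)" if "u \<in> verts J" for u
    using J_cases[OF that]
  proof
    assume "\<exists>e i. e \<in> medges H \<and> 0 < i \<and> Suc i < length (P e) \<and> u = P e ! i"
    then show ?thesis using \<psi>_inner by blast
  qed (use \<psi>_w in auto)
  have R_len: "Suc i < length (R e)" if "e \<in> medges H" "Suc i < length (P e)" for e i
    using len[OF that(1)] that(2) by simp
  have \<psi>_inj: "inj_on \<psi> (verts J)"
  proof (rule inj_onI)
    fix u v assume uv: "u \<in> verts J" "v \<in> verts J" "\<psi> u = \<psi> v"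
    consider x y where "x \<in> mverts H" "y \<in> mverts H" "u = \<phi> x" "v = \<phi> y"
      | x e i where "x \<in> mverts H" "u = \<phi> x" "e \<in> medges H" "0 < i" "Suc i < length (P e)" "v = P e ! i"
      | x e i where "x \<in> mverts H" "v = \<phi> x" "e \<in> medges H" "0 < i" "Suc i < length (P e)" "u = P e ! i"
      | e i f j where "e \<in> medges H" "0 < i" "Suc i < length (P e)" "u = P e ! i"
          "f \<in> medges H" "0 < j" "Suc j < length (P f)" "v = P f ! j"
      using J_cases[OF uv(1)] J_cases[OF uv(2)] by blast
    then show "u = v"
    proof cases
      case 1
      then show ?thesis using uv(3) \<psi>_w K_inj by (auto dest: inj_onD)
    next
      case 2
      then have "w x = R e ! i" using uv(3) \<psi>_w \<psi>_inner by simp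
      then show ?thesis using R_w[OF 2(3,4) R_len[OF 2(3,5)]] imageI[OF 2(1), of w] by simp
    next
      case 3
      then have "w x = R e ! i" using uv(3) \<psi>_w \<psi>_inner by simp
      then show ?thesis using R_w[OF 3(3,4) R_len[OF 3(3,5)]] imageI[OF 3(1), of w] by simp
    next
      case 4
      then have "R e ! i = R f ! j" using uv(3) \<psi>_inner by simp
      then show ?thesis using R_inner[OF 4(1,5,2) R_len[OF 4(1,3)] 4(6) R_len[OF 4(5,7)]] 4(4,8)
        by simp
    qed
  qed

  text \<open>The edge \<open>i\<close> of \<open>P e\<close> is replaced by the edge \<open>i\<close> of \<open>R e\<close>, except that the last edge of
    \<open>P e\<close> receives all that remains of \<open>R e\<close>.\<close>
  define hi where "hi e i = (if Suc (Suc i) < length (P e) then Suc i else length (R e) - 1)" for e i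
  define seg where "seg e i = map ((!) (R e)) [i..<Suc (hi e i)]" for e i
  have hi: "i < hi e i" "hi e i < length (R e)" if "e \<in> medges H" "Suc i < length (P e)" for e i
    using R_len[OF that] len[OF that(1)] unfolding hi_def by auto
  have hi_le: "hi e i \<le> j" if "Suc j < length (P e)" "i < j" for e i j
    using that unfolding hi_def by auto
  \<comment> \<open>Only a last segment has interior vertices. Their positions lie beyond all
    interior positions of \<open>P e\<close>, so they are not in the image of
    \<open>\<psi>\<close>.\<close>
  have hi_large: "length (P e) \<le> Suc k" if "i < k" "k < hi e i" "Suc i < length (P e)" for e i k
    using that unfolding hi_def by (auto split: if_splits)
  have seg_len: "length (seg e i) = Suc (hi e i) - i" for e i
    unfolding seg_def by (simp del: upt_Suc)
  have seg_nth: "seg e i ! k = R e ! (i + k)" if "k < length (seg e i)" for e i k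
    using that unfolding seg_def by (simp del: upt_Suc)
  have seg_edges: "path_edges (seg e i) = {{R e ! k, R e ! Suc k} |k. i \<le> k \<and> k < hi e i}"
    if "e \<in> medges H" "Suc i < length (P e)" for e i
  proof (intro set_eqI iffI)
    fix d assume "d \<in> path_edges (seg e i)"
    then obtain k where k: "Suc k < length (seg e i)" "d = {seg e i ! k, seg e i ! Suc k}"
      unfolding path_edges_def by blast
    then have "d = {R e ! (i + k), R e ! Suc (i + k)}" using seg_nth by simp
    then show "d \<in> {{R e ! k, R e ! Suc k} |k. i \<le> k \<and> k < hi e i}"
      using k(1) seg_len by (intro CollectI exI[of _ "i + k"]) auto
  next
    fix d assume "d \<in> {{R e ! k, R e ! Suc k} |k. i \<le> k \<and> k < hi e i}"
    then obtain k where k: "i \<le> k" "k < hi e i" "d = {R e ! k, R e ! Suc k}" by blast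
    then have "Suc (k - i) < length (seg e i)" using seg_len by simp
    moreover from this have "d = {seg e i ! (k - i), seg e i ! Suc (k - i)}"
      using seg_nth[of "k - i" e i] seg_nth[of "Suc (k - i)" e i] k by simp
    ultimately show "d \<in> path_edges (seg e i)" using path_edges_nth by blast
  qed
  have seg_inner: "\<exists>k. i < k \<and> k < hi e i \<and> u = R e ! k" if u: "u \<in> inner_verts (seg e i)" for e i u
  proof -
    obtain k where k: "0 < k" "Suc k < length (seg e i)" "seg e i ! k = u"
      using u unfolding inner_verts_iff by blast
    then show ?thesis using seg_nth[of k e i] seg_len[of e i] by (intro exI[of _ "i + k"]) auto
  qed
  have seg_set: "set (seg e i) = {R e ! k |k. i \<le> k \<and> k \<le> hi e i}" for e i
    unfolding seg_def by (auto simp del: upt_Suc simp: less_Suc_eq_le)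
  have seg_hd: "hd (seg e i) = R e ! i" "last (seg e i) = R e ! hi e i"
    if "e \<in> medges H" "Suc i < length (P e)" for e i
  proof -
    have "seg e i \<noteq> []" using hi[OF that] unfolding seg_def by simp
    then show "hd (seg e i) = R e ! i" "last (seg e i) = R e ! hi e i"
      using seg_nth seg_len hi[OF that] by (auto simp: hd_conv_nth last_conv_nth)
  qed

  have "\<exists>e i. e \<in> medges H \<and> Suc i < length (P e) \<and> f = {P e ! i, P e ! Suc i}" if "f \<in> edges J" for f
    using that unfolding J_edges path_edges_def by blast
  then obtain E I where EI: "\<And>f. f \<in> edges J \<Longrightarrow> E f \<in> medges H"
    "\<And>f. f \<in> edges J \<Longrightarrow> Suc (I f) < length (P (E f))"
    "\<And>f. f \<in> edges J \<Longrightarrow> f = {P (E f) ! I f, P (E f) ! Suc (I f)}"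
    by metis

  have EI_eq: "{P e ! i, P e ! Suc i} \<in> edges J" "E {P e ! i, P e ! Suc i} = e"
      "I {P e ! i, P e ! Suc i} = i" if e: "e \<in> medges H" "Suc i < length (P e)" for e i
  proof -
    let ?f = "{P e ! i, P e ! Suc i}"
    have fe: "?f \<in> path_edges (P e)" using e(2) by (rule path_edges_nth)
    then show f: "?f \<in> edges J" unfolding J_edges using e(1) by blast
    have "?f \<in> path_edges (P (E ?f))" using path_edges_nth[OF EI(2)[OF f]] EI(3)[OF f] by simp
    then show E: "E ?f = e" using fe JD(2)[OF EI(1)[OF f] e(1)] by auto
    have "{P e ! I ?f, P e ! Suc (I ?f)} = ?f" using EI(3)[OF f] unfolding E by simp
    then show "I ?f = i"
      using path_edge_index_unique[OF dist(1)[OF e(1)]] EI(2)[OF f] e(2) unfolding E by blast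
  qed
  let ?Q = "\<lambda>f. seg (E f) (I f)"
  have Q_set: "set (?Q f) \<subseteq> set (R (E f))" if "f \<in> edges J" for f
    using hi(2)[OF EI(1,2)[OF that]] unfolding seg_set by (auto intro: nth_mem)
  have Q_edges: "path_edges (?Q f) \<subseteq> path_edges (R (E f))" if f: "f \<in> edges J" for f
  proof
    fix d assume "d \<in> path_edges (?Q f)"
    then obtain k where "k < hi (E f) (I f)" "d = {R (E f) ! k, R (E f) ! Suc k}"
      unfolding seg_edges[OF EI(1,2)[OF f]] by blast
    then show "d \<in> path_edges (R (E f))"
      using path_edges_nth[of k "R (E f)"] hi(2)[OF EI(1,2)[OF f]] by simp
  qed
  have cover: "\<exists>f\<in>edges J. E f = e \<and> I f \<le> k \<and> k < hi e (I f)"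
    if e: "e \<in> medges H" and k: "Suc k < length (R e)" for e k
  proof -
    \<comment> \<open>Edge \<open>k\<close> of \<open>R e\<close> is its own segment or belongs to
      the last one, whose index is \<open>length (P e) - 2\<close>.\<close>
    let ?i = "min k (length (P e) - 2)"
    have i: "Suc ?i < length (P e)" "?i \<le> k" using len2[OF e] by auto
    have "k < hi e ?i" using k i unfolding hi_def by auto
    then show ?thesis using EI_eq[OF e i(1)] i(2) by (intro bexI[of _ "{P e ! ?i, P e ! Suc ?i}"]) simp_all
  qed

  have 1: "is_path K (?Q f) \<and> {hd (?Q f), last (?Q f)} = \<psi> ` f \<and> inner_verts (?Q f) \<inter> \<psi> ` verts J = {}"
    if f: "f \<in> edges J" for f
  proof (intro conjI)
    note e = EI(1,2)[OF f]
    have "distinct (?Q f)"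
      using dist(2)[OF e(1)] hi(2)[OF e] unfolding seg_def distinct_map
      by (auto intro!: inj_onI simp: nth_eq_iff_index_eq)
    moreover have "?Q f \<noteq> []" using hi(1)[OF e] unfolding seg_def by simp
    moreover have "set (?Q f) \<subseteq> verts K" using Q_set[OF f] e(1) unfolding K_verts by blast
    moreover have "path_edges (?Q f) \<subseteq> edges K" using Q_edges[OF f] e(1) unfolding K_edges by blast
    ultimately show "is_path K (?Q f)" unfolding is_path_def by blast
    have "\<psi> (P (E f) ! Suc (I f)) = R (E f) ! hi (E f) (I f)"
    proof (cases "Suc (Suc (I f)) < length (P (E f))")
      case True
      then show ?thesis using \<psi>_nth[OF e(1)] unfolding hi_def by simp
    next
      case False
      then have "Suc (I f) = length (P (E f)) - 1" using e(2) by simp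
      then show ?thesis using \<psi>_last[OF e(1)] False unfolding hi_def by simp
    qed
    then have "\<psi> ` {P (E f) ! I f, P (E f) ! Suc (I f)} = {hd (?Q f), last (?Q f)}"
      using \<psi>_nth[OF e] seg_hd[OF e] by simp
    then show "{hd (?Q f), last (?Q f)} = \<psi> ` f" using EI(3)[OF f] by simp
    show "inner_verts (?Q f) \<inter> \<psi> ` verts J = {}"
    proof (rule ccontr)
      assume "inner_verts (?Q f) \<inter> \<psi> ` verts J \<noteq> {}"
      then obtain u where u: "u \<in> verts J" "\<psi> u \<in> inner_verts (?Q f)" by blast
      then obtain k where k: "I f < k" "k < hi (E f) (I f)" "\<psi> u = R (E f) ! k"
        using seg_inner by blast
      have k': "length (P (E f)) \<le> Suc k" "Suc k < length (R (E f))"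
        using hi_large[OF k(1,2) e(2)] hi(2)[OF e] k(2) by auto
      from \<psi>_image[OF u(1)] show False
      proof
        assume "\<psi> u \<in> w ` mverts H"
        then show False using R_w[OF e(1) _ k'(2)] k(1,3) by simp
      next
        assume "\<exists>e i. e \<in> medges H \<and> 0 < i \<and> Suc i < length (P e) \<and> \<psi> u = R e ! i"
        then obtain e' i where i: "e' \<in> medges H" "0 < i" "Suc i < length (P e')" "\<psi> u = R e' ! i"
          by blast
        then have "E f = e' \<and> k = i"
          using R_inner[OF e(1) i(1) _ k'(2) i(2) R_len[OF i(1,3)]] k(1,3) by simp
        then show False using i(3) k'(1) by simp
      qed
    qed
  qed
  have 2: "inner_verts (?Q f) \<inter> inner_verts (?Q g) = {} \<and> path_edges (?Q f) \<inter> path_edges (?Q g) = {}"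
    if f: "f \<in> edges J" and g: "g \<in> edges J" and fg: "f \<noteq> g" for f g
  proof -
    note e = EI(1,2)[OF f] and e' = EI(1,2)[OF g]
    have sep: False if "E f = E g" "I f \<le> k" "k < hi (E f) (I f)" "I g \<le> k" "k < hi (E g) (I g)" for k
    proof -
      have "I f \<noteq> I g" using fg EI(3)[OF f] EI(3)[OF g] that(1) by metis
      then show False
        using hi_le[of "I g" "E g" "I f"] hi_le[of "I f" "E f" "I g"] that e(2) e'(2)
        by (metis leD le_less_trans less_le_trans linorder_neqE_nat)
    qed
    have "inner_verts (?Q f) \<inter> inner_verts (?Q g) = {}"
    proof (rule ccontr)
      assume "\<not> ?thesis"
      then obtain u where u: "u \<in> inner_verts (?Q f)" "u \<in> inner_verts (?Q g)" by blast
      obtain k where k: "I f < k" "k < hi (E f) (I f)" "u = R (E f) ! k" using seg_inner[OF u(1)] by blast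
      obtain l where l: "I g < l" "l < hi (E g) (I g)" "u = R (E g) ! l" using seg_inner[OF u(2)] by blast
      have "E f = E g \<and> k = l"
        by (rule R_inner[OF e(1) e'(1)]) (use k l hi(2)[OF e] hi(2)[OF e'] in auto)
      then show False using sep[of k] k l by simp
    qed
    moreover have "path_edges (?Q f) \<inter> path_edges (?Q g) = {}"
    proof (rule ccontr)
      assume "\<not> ?thesis"
      then obtain d where d: "d \<in> path_edges (?Q f)" "d \<in> path_edges (?Q g)" by blast
      have EE: "E f = E g"
        using d Q_edges[OF f] Q_edges[OF g] KD(2)[OF e(1) e'(1)] by blast
      obtain k where k: "I f \<le> k" "k < hi (E f) (I f)" "d = {R (E f) ! k, R (E f) ! Suc k}"
        using d(1) unfolding seg_edges[OF e] by blast
      obtain l where l: "I g \<le> l" "l < hi (E g) (I g)" "d = {R (E g) ! l, R (E g) ! Suc l}"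
        using d(2) unfolding seg_edges[OF e'] by blast
      have "k = l"
        by (rule path_edge_index_unique[OF dist(2)[OF e(1)]]) (use k l hi(2)[OF e] hi(2)[OF e'] EE in auto)
      then show False using sep[of k] EE k l by simp
    qed
    ultimately show ?thesis by blast
  qed
  have 3: "verts K = \<psi> ` verts J \<union> (\<Union>f\<in>edges J. set (?Q f))"
  proof (intro equalityI subsetI)
    fix u assume "u \<in> verts K"
    then consider v where "v \<in> mverts H" "u = w v" | e where "e \<in> medges H" "u \<in> set (R e)"
      unfolding K_verts by blast
    then show "u \<in> \<psi> ` verts J \<union> (\<Union>f\<in>edges J. set (?Q f))"
    proof cases
      case 1
      then have "u = \<psi> (\<phi> v)" "\<phi> v \<in> verts J" using \<psi>_w unfolding J_verts by auto
      then show ?thesis by blast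
    next
      case 2
      then obtain k where k: "k < length (R e)" "u = R e ! k" by (auto simp: in_set_conv_nth)
      \<comment> \<open>Vertex \<open>k\<close> is found on edge \<open>k - 1\<close>; for
        \<open>k = 0\<close> truncated subtraction gives edge 0, which also contains it.\<close>
      have l: "Suc (k - 1) < length (R e)" using k(1) len[OF 2(1)] len2[OF 2(1)] by auto
      obtain f where f: "f \<in> edges J" "E f = e" "I f \<le> k - 1" "k - 1 < hi e (I f)"
        using cover[OF 2(1) l] by blast
      have "u \<in> set (?Q f)" unfolding seg_set using f k by (intro CollectI exI[of _ k]) auto
      then show ?thesis using f(1) by blast
    qed
  next
    fix u assume "u \<in> \<psi> ` verts J \<union> (\<Union>f\<in>edges J. set (?Q f))"
    then show "u \<in> verts K"
    proof
      assume "u \<in> \<psi> ` verts J"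
      then obtain v where v: "v \<in> verts J" "u = \<psi> v" by blast
      from \<psi>_image[OF v(1)] show ?thesis
      proof
        assume "\<exists>e i. e \<in> medges H \<and> 0 < i \<and> Suc i < length (P e) \<and> \<psi> v = R e ! i"
        then obtain e i where i: "e \<in> medges H" "Suc i < length (P e)" "u = R e ! i" using v(2) by blast
        then have "u \<in> set (R e)" using R_len[OF i(1,2)] by auto
        then show ?thesis unfolding K_verts using i(1) by blast
      qed (use v(2) K_verts in blast)
    next
      assume "u \<in> (\<Union>f\<in>edges J. set (?Q f))"
      then show ?thesis using Q_set EI(1) unfolding K_verts by blast
    qed
  qed
  have 4: "edges K = (\<Union>f\<in>edges J. path_edges (?Q f))"
  proof (intro equalityI subsetI)
    fix d assume "d \<in> edges K"
    then obtain e k where e: "e \<in> medges H" "Suc k < length (R e)" "d = {R e ! k, R e ! Suc k}"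
      unfolding K_edges path_edges_def by blast
    obtain f where f: "f \<in> edges J" "E f = e" "I f \<le> k" "k < hi e (I f)"
      using cover[OF e(1,2)] by blast
    then have "d \<in> path_edges (?Q f)" unfolding seg_edges[OF EI(1,2)[OF f(1)]] using e(3) by blast
    then show "d \<in> (\<Union>f\<in>edges J. path_edges (?Q f))" using f(1) by blast
  next
    fix d assume "d \<in> (\<Union>f\<in>edges J. path_edges (?Q f))"
    then show "d \<in> edges K" using Q_edges EI(1) unfolding K_edges by blast
  qed
  have "subdivision_via K (mgraph_of J) \<psi> ?Q"
    unfolding subdivision_via_def mgraph_of_def
    using \<psi>_inj 1 2 3 4 by simp
  then show ?thesis unfolding is_subdivision_iff using K by blast
qed

section \<open>The main theorem\<close>

lemma link_model_transfer:
  assumes model: "link_model A VS ES ends L w W"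
    and p: "inj_on p VS'" "p ` VS' \<subseteq> VS" and h: "inj_on h ES'" "h ` ES' \<subseteq> ES"
    and ends': "\<And>e. e \<in> ES' \<Longrightarrow> ends' e \<subseteq> VS' \<and> ends (h e) = p ` ends' e"
  shows "link_model A VS' ES' ends' L (w \<circ> p) (W \<circ> h)"
  unfolding link_model_def
proof (intro conjI ballI impI)
  fix a b assume "a \<in> VS'" "b \<in> VS'" "a \<noteq> b"
  then have "p a \<in> VS" "p b \<in> VS" "p a \<noteq> p b" using p by (auto dest: inj_onD)
  then show "\<not> near A L ((w \<circ> p) a) ((w \<circ> p) b)" using model unfolding link_model_def by simp
next
  fix e assume e: "e \<in> ES'"
  then have "h e \<in> ES" using h(2) by blast
  then have he: "conn A (W (h e))" "\<And>b. b \<in> VS \<Longrightarrow> w b \<notin> W (h e)"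
    "\<And>b. b \<in> VS \<Longrightarrow> touches A (w b) (W (h e)) \<longleftrightarrow> b \<in> ends (h e)"
    using model unfolding link_model_def by simp_all
  show "conn A ((W \<circ> h) e)" using he(1) by simp
  fix b assume b: "b \<in> VS'"
  then have pb: "p b \<in> VS" using p(2) by blast
  show "(w \<circ> p) b \<notin> (W \<circ> h) e" using he(2)[OF pb] by simp
  have "p b \<in> p ` ends' e \<longleftrightarrow> b \<in> ends' e"
    using ends'[OF e] b inj_on_image_mem_iff[OF p(1)] by blast
  then show "touches A ((w \<circ> p) b) ((W \<circ> h) e) \<longleftrightarrow> b \<in> ends' e"
    using he(3)[OF pb] ends'[OF e] by simp
next
  fix e f assume "e \<in> ES'" "f \<in> ES'" "e \<noteq> f"
  then have "h e \<in> ES" "h f \<in> ES" "h e \<noteq> h f" using h by (auto dest: inj_onD)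
  then show "anti A ((W \<circ> h) e) ((W \<circ> h) f)" using model unfolding link_model_def by simp
qed

text \<open>The cycle is rotated so that \<open>e0\<close> becomes the closing edge, as
  \<open>fat_cycle_ends\<close> expects.\<close>

lemma cycle_starting_after:
  assumes "is_cycle C" "e0 \<in> edges C"
  obtains ys m where "length ys = Suc m" "distinct ys" "verts C = set ys" "e0 = {ys ! m, ys ! 0}"
    "\<And>f. f \<in> edges C \<Longrightarrow> \<exists>k\<le>m. f = {ys ! k, ys ! (if k = m then 0 else Suc k)}"
    "\<And>k. k \<le> m \<Longrightarrow> {ys ! k, ys ! (if k = m then 0 else Suc k)} \<in> edges C"
proof -
  obtain xs where xs: "3 \<le> length xs" "distinct xs" "verts C = set xs"
    "edges C = {{xs ! i, xs ! (Suc i mod length xs)} |i. i < length xs}"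
    using assms(1) unfolding is_cycle_def by blast
  let ?n = "length xs"
  obtain i0 where i0: "i0 < ?n" "e0 = {xs ! i0, xs ! (Suc i0 mod ?n)}"
    using assms(2) unfolding xs(4) by blast
  define ys where "ys = rotate (Suc i0) xs"
  define m where "m = ?n - 1"
  have n: "?n = Suc m" using xs(1) unfolding m_def by simp
  have ys: "ys ! k = xs ! ((Suc i0 + k) mod ?n)" if "k < ?n" for k
    unfolding ys_def using that by (rule nth_rotate)
  have next_mod: "(if k = m then 0 else Suc k) = Suc k mod ?n" if "k \<le> m" for k
    using that unfolding n by auto
  have edge: "{ys ! k, ys ! (if k = m then 0 else Suc k)} =
      {xs ! ((Suc i0 + k) mod ?n), xs ! (Suc ((Suc i0 + k) mod ?n) mod ?n)}" if k: "k \<le> m" for k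
  proof -
    have "(Suc i0 + Suc k mod ?n) mod ?n = Suc ((Suc i0 + k) mod ?n) mod ?n"
      by (metis add_Suc_right mod_Suc_eq mod_add_right_eq)
    moreover have "Suc k mod ?n < ?n" unfolding n by simp
    ultimately show ?thesis using ys[of k] ys[of "Suc k mod ?n"] k next_mod[OF k] n by simp
  qed
  have "\<exists>k\<le>m. f = {ys ! k, ys ! (if k = m then 0 else Suc k)}" if "f \<in> edges C" for f
  proof -
    obtain i where i: "i < ?n" "f = {xs ! i, xs ! (Suc i mod ?n)}"
      using \<open>f \<in> edges C\<close> unfolding xs(4) by blast
    \<comment> \<open>The inverse of the rotation; adding \<open>?n\<close> first keeps the
      subtraction from truncating.\<close>
    let ?k = "(i + ?n - Suc i0) mod ?n"
    have "(Suc i0 + ?k) mod ?n = (Suc i0 + (i + ?n - Suc i0)) mod ?n" by (rule mod_add_right_eq)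
    also have "Suc i0 + (i + ?n - Suc i0) = i + ?n" using i0(1) by simp
    finally have k: "(Suc i0 + ?k) mod ?n = i" using i(1) by simp
    have "?k < ?n" unfolding n by simp
    then have "?k \<le> m" using n by simp
    then show ?thesis using edge[of ?k] i(2) unfolding k by blast
  qed
  moreover have "{ys ! k, ys ! (if k = m then 0 else Suc k)} \<in> edges C" if "k \<le> m" for k
  proof -
    have "(Suc i0 + k) mod ?n < ?n" unfolding n by simp
    then show ?thesis unfolding edge[OF that] xs(4) by blast
  qed
  moreover have "e0 = {ys ! m, ys ! 0}"
  proof -
    have "Suc i0 + m = i0 + ?n" using n by simp
    moreover have "(i0 + ?n) mod ?n = i0" using i0(1) by simp
    ultimately have "(Suc i0 + m) mod ?n = i0" by (simp only:)
    then show ?thesis using ys[of m] ys[of 0] i0(2) n by simp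
  qed
  moreover have "length ys = Suc m" "distinct ys" "verts C = set ys"
    unfolding ys_def using n xs(2,3) by simp_all
  ultimately show thesis using that by blast
qed

text \<open>No parallel class has more than \<open>card (medges H)\<close> edges, so this
  multiplicity is enough. The second conclusion says that no vertex of \<open>H\<close> is isolated;
  it later shows that the branch vertices are vertices of the graph.\<close>

lemma fat_cycle_link_model:
  assumes C: "is_cycle C" and e0: "e0 \<in> edges C"
    and H: "obtained_by_fattening (edges C - {e0}) (mgraph_of C) H"
    and fat: "has_fat_cycle A (card (verts C) - 1) (card (medges H)) L"
  obtains w W where "link_model A (mverts H) (medges H) (mends H) L w W"
    "mverts H = \<Union> (mends H ` medges H)"
proof -
  obtain \<pi> where H': "multigraph H" "mverts H = verts C" "\<pi> ` medges H = edges C"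
    "\<And>e. e \<in> medges H \<Longrightarrow> mends H e = \<pi> e" "\<exists>!e. e \<in> medges H \<and> \<pi> e = e0"
    using H e0 unfolding obtained_by_fattening_def mgraph_of_def by auto
  obtain ys m where ys: "length ys = Suc m" "distinct ys" "verts C = set ys" "e0 = {ys ! m, ys ! 0}"
    "\<And>f. f \<in> edges C \<Longrightarrow> \<exists>k\<le>m. f = {ys ! k, ys ! (if k = m then 0 else Suc k)}"
    "\<And>k. k \<le> m \<Longrightarrow> {ys ! k, ys ! (if k = m then 0 else Suc k)} \<in> edges C"
    using cycle_starting_after[OF C e0] by metis
  have m: "card (verts C) - 1 = m" using ys(1-3) by (simp add: distinct_card)
  obtain w W where wW: "link_model A {..m} (fat_cycle_edges m (card (medges H))) (fat_cycle_ends m) L w W"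
    using fat unfolding m has_fat_cycle_def by blast
  have fin: "finite (medges H)" using H'(1) unfolding multigraph_def by blast
  obtain g where g: "g ` medges H \<subseteq> {..<card (medges H)}" "inj_on g (medges H)"
    using card_le_inj[OF fin, of "{..<card (medges H)}"] by auto
  have "\<exists>k. (\<pi> e = e0 \<longleftrightarrow> k = m) \<and> k \<le> m \<and> \<pi> e = {ys ! k, ys ! (if k = m then 0 else Suc k)}"
    if e: "e \<in> medges H" for e
  proof (cases "\<pi> e = e0")
    case True
    then show ?thesis using ys(4) by (intro exI[of _ m]) simp
  next
    case False
    have "\<pi> e \<in> edges C" using H'(3) e by blast
    then obtain k where k: "k \<le> m" "\<pi> e = {ys ! k, ys ! (if k = m then 0 else Suc k)}"
      using ys(5) by blast
    have "k \<noteq> m"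
    proof
      assume "k = m"
      then have "\<pi> e = e0" using k(2) ys(4) by simp
      then show False using False by simp
    qed
    then show ?thesis using k False by (intro exI[of _ k]) simp
  qed
  then obtain \<kappa> where \<kappa>: "\<And>e. e \<in> medges H \<Longrightarrow> \<pi> e = e0 \<longleftrightarrow> \<kappa> e = m"
    "\<And>e. e \<in> medges H \<Longrightarrow> \<kappa> e \<le> m"
    "\<And>e. e \<in> medges H \<Longrightarrow> \<pi> e = {ys ! \<kappa> e, ys ! (if \<kappa> e = m then 0 else Suc (\<kappa> e))}"
    by metis
  \<comment> \<open>One numbering \<open>g\<close> of all edges tells parallel edges apart in every
    class; over \<open>e0\<close> there is a single edge, and the label 0 suffices.\<close>
  define h where "h e = (\<kappa> e, if \<kappa> e = m then 0 else g e)" for e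
  define p where "p = inv_into {..m} ((!) ys)"
  have inj_ys: "inj_on ((!) ys) {..m}"
    using ys(1,2) by (auto intro!: inj_onI simp: nth_eq_iff_index_eq)
  have set_ys: "set ys = (!) ys ` {..m}" using ys(1) by (auto simp: set_conv_nth less_Suc_eq_le)
  have p_ys: "p (ys ! k) = k" if "k \<le> m" for k
    unfolding p_def using inv_into_f_f[OF inj_ys] that by simp
  have "inj_on p (mverts H)" unfolding H'(2) ys(3) set_ys p_def by (rule inj_on_inv_into) simp
  moreover have "p ` mverts H \<subseteq> {..m}" unfolding H'(2) ys(3) set_ys using p_ys by auto
  moreover have "inj_on h (medges H)"
  proof (rule inj_onI)
    fix e f assume ef: "e \<in> medges H" "f \<in> medges H" "h e = h f"
    show "e = f"
    proof (cases "\<kappa> e = m")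
      case True
      then have "\<pi> e = e0" "\<pi> f = e0" using \<kappa>(1) ef unfolding h_def by auto
      then show ?thesis using H'(5) ef(1,2) by blast
    next
      case False
      then have "g e = g f" using ef(3) unfolding h_def by auto
      then show ?thesis using g(2) ef(1,2) by (auto dest: inj_onD)
    qed
  qed
  moreover have "h ` medges H \<subseteq> fat_cycle_edges m (card (medges H))"
  proof
    fix d assume "d \<in> h ` medges H"
    then obtain e where e: "e \<in> medges H" "d = h e" by blast
    then have "g e < card (medges H)" using g(1) by blast
    then show "d \<in> fat_cycle_edges m (card (medges H))"
      using \<kappa>(2)[OF e(1)] e(2) unfolding h_def fat_cycle_edges_def by (cases "\<kappa> e = m") auto
  qed
  moreover have "mends H e \<subseteq> mverts H \<and> fat_cycle_ends m (h e) = p ` mends H e"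
    if e: "e \<in> medges H" for e
  proof
    show "mends H e \<subseteq> mverts H" using H'(1) e unfolding multigraph_def by blast
    have "(if \<kappa> e = m then 0 else Suc (\<kappa> e)) \<le> m" using \<kappa>(2)[OF e] by auto
    then have "p ` mends H e = {\<kappa> e, if \<kappa> e = m then 0 else Suc (\<kappa> e)}"
      unfolding H'(4)[OF e] \<kappa>(3)[OF e] using p_ys \<kappa>(2)[OF e] by simp
    then show "fat_cycle_ends m (h e) = p ` mends H e" unfolding fat_cycle_ends_def h_def by simp
  qed
  ultimately have "link_model A (mverts H) (medges H) (mends H) L (w \<circ> p) (W \<circ> h)"
    by (rule link_model_transfer[OF wW])
  moreover have "mverts H \<subseteq> \<Union> (mends H ` medges H)"
  proof
    fix v assume "v \<in> mverts H"
    then obtain k where k: "k \<le> m" "v = ys ! k" unfolding H'(2) ys(3) set_ys by auto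
    then obtain e where "e \<in> medges H" "\<pi> e = {ys ! k, ys ! (if k = m then 0 else Suc k)}"
      using ys(6)[OF k(1)] H'(3) by (metis imageE)
    then show "v \<in> \<Union> (mends H ` medges H)" using H'(4) k(2) by auto
  qed
  moreover have "\<Union> (mends H ` medges H) \<subseteq> mverts H"
    using H'(1) unfolding multigraph_def by blast
  ultimately show thesis using that by blast
qed

text \<open>A path of \<open>J\<close> has at most \<open>card (verts J)\<close> vertices, and every
  path of the model has more than \<open>L\<close>, so the refinement lemma applies.\<close>

lemma link_model_not_subdivision_free:
  assumes G: "simple_graph G" and H: "multigraph H"
    and model: "link_model (adjacent G) (mverts H) (medges H) (mends H) L w W"
    and cover: "mverts H = \<Union> (mends H ` medges H)"
    and J: "is_subdivision J H" and L: "card (verts J) \<le> L" "2 \<le> L"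
  shows "\<not> subdivision_free (mgraph_of J) G"
proof -
  obtain \<phi> P where JP: "subdivision_via J H \<phi> P" and Js: "simple_graph J"
    using J unfolding is_subdivision_iff by blast
  have "\<exists>a b. mends H e = {a, b} \<and> hd (P e) = \<phi> a \<and> last (P e) = \<phi> b" if e: "e \<in> medges H" for e
  proof -
    obtain x y where xy: "mends H e = {x, y}"
      using H e unfolding multigraph_def by (metis card_2_iff)
    then have "{hd (P e), last (P e)} = {\<phi> x, \<phi> y}" using subdivision_viaD(3)[OF JP e] by simp
    then show ?thesis using xy by (auto simp: doubleton_eq_iff)
  qed
  then obtain a b where ab: "\<And>e. e \<in> medges H \<Longrightarrow>
      mends H e = {a e, b e} \<and> hd (P e) = \<phi> (a e) \<and> last (P e) = \<phi> (b e)"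
    by metis
  \<comment> \<open>A link model speaks of elements of the type; having a neighbour makes an element
    a vertex of \<open>G\<close>.\<close>
  have "w ` mverts H \<subseteq> verts G"
  proof
    fix u assume "u \<in> w ` mverts H"
    then obtain v e where v: "v \<in> mverts H" "u = w v" "e \<in> medges H" "v \<in> mends H e"
      using cover by blast
    then have "touches (adjacent G) (w v) (W e)" using model unfolding link_model_def by simp
    then show "u \<in> verts G" using adjacent_verts[OF G] v(2) unfolding touches_def by blast
  qed
  then obtain S R where SR: "S \<subseteq> verts G" "subdivision_via (induced G S) H w R"
    "\<And>e. e \<in> medges H \<Longrightarrow> hd (R e) = w (a e) \<and> last (R e) = w (b e) \<and> L < length (R e)"
    using link_model_induced_subdivision[OF G H L(2) model, of a b] ab by metis
  have "is_subdivision (induced G S) (mgraph_of J)"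
  proof (rule subdivision_refines[OF simple_graph_induced[OF G] JP SR(2) H])
    fix e assume e: "e \<in> medges H"
    show "mends H e = {a e, b e} \<and> hd (P e) = \<phi> (a e) \<and> last (P e) = \<phi> (b e) \<and>
        hd (R e) = w (a e) \<and> last (R e) = w (b e)"
      using ab[OF e] SR(3)[OF e] by blast
    have "distinct (P e)" "set (P e) \<subseteq> verts J"
      using subdivision_viaD(2)[OF JP e] unfolding is_path_def by auto
    moreover have "finite (verts J)" using Js unfolding simple_graph_def by blast
    ultimately have "length (P e) \<le> card (verts J)" by (metis card_mono distinct_card)
    then show "length (P e) \<le> length (R e)" using SR(3)[OF e] L(1) by simp
  qed
  then show ?thesis using SR(1) unfolding subdivision_free_def by blast
qed

section \<open>Translating chromatic numbers and balls of graphs\<close>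

lemma chromatic_number_le:
  assumes "col (adjacent G) (verts G) k" "simple_graph G"
  shows "chromatic_number G \<le> k"
proof -
  obtain c where c: "\<forall>v\<in>verts G. c v < k"
    "\<forall>u\<in>verts G. \<forall>v\<in>verts G. adjacent G u v \<longrightarrow> c u \<noteq> (c v :: nat)"
    using assms(1) unfolding col_def by blast
  have "c u \<noteq> c v" if "{u, v} \<in> edges G" for u v
  proof -
    have "adjacent G u v" using that unfolding adjacent_def .
    then show ?thesis using c(2) adjacent_verts[OF assms(2)] by blast
  qed
  then have "proper_colouring G k c" using c(1) unfolding proper_colouring_def by blast
  then show ?thesis unfolding chromatic_number_def by (intro Least_le) blast
qed

lemma col_chromatic_number:
  assumes "simple_graph G"
  shows "col (adjacent G) (verts G) (chromatic_number G)"
proof -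
  have "finite (verts G)" using assms unfolding simple_graph_def by blast
  then obtain h where h: "bij_betw h (verts G) {0..<card (verts G)}"
    using ex_bij_betw_finite_nat by blast
  \<comment> \<open>Some colouring must exist before the \<open>LEAST\<close> in
    \<open>chromatic_number\<close> means anything; an injective numbering is one.\<close>
  have "proper_colouring G (card (verts G)) h"
    unfolding proper_colouring_def
  proof (intro conjI ballI allI impI)
    fix v assume "v \<in> verts G"
    then show "h v < card (verts G)" using bij_betwE[OF h] by auto
  next
    fix u v assume "u \<noteq> v" "{u, v} \<in> edges G"
    moreover from this have "u \<in> verts G" "v \<in> verts G"
      using assms unfolding simple_graph_def by auto
    ultimately show "h u \<noteq> h v" using h unfolding bij_betw_def by (auto dest: inj_onD)
  qed
  then have "\<exists>k c. proper_colouring G k c" by blast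
  then have "\<exists>c. proper_colouring G (chromatic_number G) c"
    unfolding chromatic_number_def by (rule LeastI_ex)
  then obtain c where c: "proper_colouring G (chromatic_number G) c" by blast
  have "c u \<noteq> c v" if "adjacent G u v" for u v
  proof -
    have "u \<noteq> v" using that irreflp_adjacent[OF assms] by (auto dest: irreflpD)
    then show ?thesis using c that unfolding proper_colouring_def adjacent_def by simp
  qed
  moreover have "\<forall>v\<in>verts G. c v < chromatic_number G"
    using c unfolding proper_colouring_def by simp
  ultimately show ?thesis unfolding col_def by blast
qed

text \<open>\<open>graph_dist\<close> minimises over paths of \<open>G\<close>, \<open>near\<close>
  over walks in the type. A shortest walk is a path, and from a vertex of \<open>G\<close> adjacency
  never leaves \<open>G\<close>.\<close>

lemma near_nbhd:
  assumes G: "simple_graph G" and v: "v \<in> verts G" and near: "near (adjacent G) \<rho> v u"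
  shows "u \<in> nbhd \<rho> G v"
proof -
  let ?A = "adjacent G"
  obtain j where j: "j \<le> \<rho>" "(v, u) \<in> adj_in ?A UNIV ^^ j" using near unfolding near_def by blast
  have "(v, u) \<in> (adj_in ?A UNIV)\<^sup>*" using j(2) by (rule relpow_imp_rtrancl)
  then obtain p where p: "p \<noteq> []" "hd p = v" "last p = u" "distinct p"
    "length p = Suc (lev ?A UNIV v u)" "\<And>i. Suc i < length p \<Longrightarrow> ?A (p ! i) (p ! Suc i)"
    using shortest_path[OF symp_adjacent irreflp_adjacent[OF G] _ UNIV_I] by metis
  have "p ! i \<in> verts G" if "i < length p" for i
  proof (cases i)
    case 0
    then show ?thesis using p(1,2) v by (simp add: hd_conv_nth)
  next
    case (Suc i')
    then show ?thesis using p(6)[of i'] adjacent_verts[OF G] that by blast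
  qed
  then have set_p: "set p \<subseteq> verts G" by (auto simp: in_set_conv_nth)
  moreover have "path_edges p \<subseteq> edges G"
    using p(6) unfolding path_edges_def adjacent_def by blast
  ultimately have "p \<in> {p. is_path G p \<and> hd p = v \<and> last p = u}"
    using p(1-4) unfolding is_path_def by blast
  then have "graph_dist G v u \<le> enat (length p - 1)"
    unfolding graph_dist_def by (rule INF_lower)
  also have "length p - 1 \<le> \<rho>" using p(5) lev_le[OF j(2)] j(1) by simp
  finally have "graph_dist G v u \<le> enat \<rho>" by simp
  moreover have "u \<in> verts G" using p(1,3) set_p by auto
  ultimately show ?thesis unfolding nbhd_def by blast
qed

text \<open>An element outside \<open>G\<close> is a ball of its own and needs one colour even if
  \<open>\<tau> = 0\<close>; hence \<open>Suc \<tau>\<close>.\<close>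

lemma locally_col_if_local_chromatic_number:
  assumes G: "simple_graph G" and \<tau>: "local_chromatic_number \<rho> G \<le> \<tau>"
  shows "locally_col (adjacent G) (Suc \<tau>) \<rho>"
proof -
  let ?A = "adjacent G"
  have "col ?A {u. near ?A \<rho> v u} (Suc \<tau>)" for v
  proof (cases "v \<in> verts G")
    case True
    let ?B = "nbhd \<rho> G v"
    have "finite (verts G)" using G unfolding simple_graph_def by blast
    then have "chromatic_number (induced G ?B) \<le>
        Max ((\<lambda>v. chromatic_number (induced G (nbhd \<rho> G v))) ` verts G)"
      using True by (intro Max_ge) auto
    also have "\<dots> \<le> \<tau>" using \<tau> True unfolding local_chromatic_number_def by (auto split: if_splits)
    finally have "col (adjacent (induced G ?B)) (verts (induced G ?B)) (Suc \<tau>)"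
      using col_mono[OF col_chromatic_number[OF simple_graph_induced[OF G]] order_refl] by simp
    moreover have "verts (induced G ?B) = ?B" unfolding induced_def nbhd_def by auto
    ultimately have "col (adjacent (induced G ?B)) ?B (Suc \<tau>)" by simp
    then have "col ?A ?B (Suc \<tau>)" unfolding col_def adjacent_def induced_def by simp
    then show ?thesis by (rule col_mono) (use near_nbhd[OF G True] in auto)
  next
    case False
    have "u = v" if "near ?A \<rho> v u" for u
    proof -
      obtain j where j: "(v, u) \<in> adj_in ?A UNIV ^^ j" using \<open>near ?A \<rho> v u\<close> unfolding near_def by blast
      show ?thesis
      proof (cases j)
        case (Suc i)
        then obtain x where "(v, x) \<in> adj_in ?A UNIV" using j relpow_Suc_D2 by metis
        then have "?A v x" unfolding adj_in_def by simp
        then show ?thesis using False adjacent_verts[OF G] by blast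
      qed (use j in simp)
    qed
    then have "{u. near ?A \<rho> v u} \<subseteq> {v}" by blast
    moreover have "col ?A {v} (Suc \<tau>)"
      unfolding col_def using irreflp_adjacent[OF G] by (intro exI[of _ "\<lambda>_. 0"]) (auto dest: irreflpD)
    ultimately show ?thesis using col_mono by blast
  qed
  then show ?thesis
    unfolding locally_col_def using symp_adjacent irreflp_adjacent[OF G] by blast
qed

theorem mainTheorem3:
  fixes C :: "'v graph" and e0 :: "'v set" and H :: "('v, 'e) mgraph"
  assumes "is_cycle C"
    and "e0 \<in> edges C"
    and "obtained_by_fattening (edges C - {e0}) (mgraph_of C) H"
  shows "widespread H"
  unfolding widespread_def
proof (intro allI impI)
  fix J :: "nat graph"
  assume J: "is_subdivision J H"
  \<comment> \<open>\<open>card (verts J)\<close> exceeds or equals every path of \<open>J\<close>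
    in number of vertices, and the summand 2 gives \<open>2 \<le> ?L\<close>. The radius below is
    larger by another 2, the loss in passing to parents.\<close>
  let ?L = "card (verts J) + 2" and ?m = "card (verts C) - 1" and ?M = "card (medges H)"
  have H: "multigraph H" using assms(3) unfolding obtained_by_fattening_def by blast
  show "\<exists>\<rho>. \<forall>\<C>. ideal \<C> \<and> rho_bounded \<rho> \<C> \<and> (\<forall>G\<in>\<C>. subdivision_free (mgraph_of J) G) \<longrightarrow>
    colourable \<C>"
  proof (intro exI[of _ "?L + 2"] allI impI, elim conjE)
    fix \<C>
    assume ideal: "ideal \<C>" and bounded: "rho_bounded (?L + 2) \<C>"
      and free: "\<forall>G\<in>\<C>. subdivision_free (mgraph_of J) G"
    obtain \<tau> where \<tau>: "\<And>G. G \<in> \<C> \<Longrightarrow> local_chromatic_number (?L + 2) G \<le> \<tau>"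
      using bounded unfolding rho_bounded_def by blast
    have L: "?L + 2 - 2 = ?L" "4 \<le> ?L + 2" by simp_all
    \<comment> \<open>\<open>K\<close> depends on \<open>\<tau>\<close>, \<open>J\<close>,
      \<open>C\<close> and \<open>H\<close> but not on the member of the ideal, so it bounds all
      chromatic numbers at once.\<close>
    obtain K where K: "\<And>A (D :: nat set). locally_col A (Suc \<tau>) (?L + 2) \<Longrightarrow> finite D \<Longrightarrow>
        \<not> col A D K \<Longrightarrow> has_fat_cycle A ?m ?M ?L"
      using exists_fat_cycle[OF L(2), of "Suc \<tau>" ?m ?M] unfolding L(1) by blast
    have "chromatic_number G \<le> K" if G: "G \<in> \<C>" for G
    proof -
      have Gs: "simple_graph G" using ideal G unfolding ideal_def by blast
      have "col (adjacent G) (verts G) K"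
      proof (rule ccontr)
        assume "\<not> col (adjacent G) (verts G) K"
        moreover have "finite (verts G)" using Gs unfolding simple_graph_def by blast
        ultimately have fat: "has_fat_cycle (adjacent G) ?m ?M ?L"
          using K locally_col_if_local_chromatic_number[OF Gs \<tau>[OF G]] by blast
        obtain w W where "link_model (adjacent G) (mverts H) (medges H) (mends H) ?L w W"
          "mverts H = \<Union> (mends H ` medges H)"
          using fat_cycle_link_model[OF assms fat] by metis
        then have "\<not> subdivision_free (mgraph_of J) G"
          by (rule link_model_not_subdivision_free[OF Gs H _ _ J]) simp_all
        then show False using free G by blast
      qed
      then show ?thesis using Gs by (rule chromatic_number_le)
    qed
    then show "colourable \<C>" unfolding colourable_def by blast
  qed
qed

end
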